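(* Let $\varphi\in L^{2}(\mathbb{R}^{2n})$ satisfy condition C. Assume that $\frac{1}{w_{\varphi}}\in L^{1}(\mathbb{T}^{n})$. If $\{T^{t}_{(k,l)}\varphi:(k,l)\in\mathbb{Z}^{2n}\}$ is Hilbertian, then $\|w_{\varphi}\|_{\infty}<\infty$.
   Context: $\mathbb{T}^{n}$ is identified with $[0,1)^{n}$ with Lebesgue measure; $\|\cdot\|_\infty$ is the $L^{\infty}(\mathbb{T}^{n})$ norm. Twisted translation: for $\varphi\in L^{2}(\mathbb{R}^{2n})$ and $(k,l)\in\mathbb{Z}^{2n}$ (with $k,l\in\mathbb{Z}^n$), $T^{t}_{(k,l)}\varphi(x,y)=e^{\pi i(x\cdot l-y\cdot k)}\varphi(x-k,y-l)$, $(x,y)\in\mathbb{R}^{n}\times\mathbb{R}^{n}$. Kernel of the Weyl transform: for $f\in L^{2}(\mathbb{R}^{2n})$, $K_{f}(\xi,\eta)=\int_{\mathbb{R}^{n}}f(x,\eta-\xi)e^{i\pi x\cdot(\xi+\eta)}dx$ (interpreted in the $L^{2}$ sense as a partial Fourier transform; $f\mapsto K_f$ is an isometry of $L^{2}(\mathbb{R}^{2n})$). $w_{\varphi}(\xi)=\sum_{m\in\mathbb{Z}^{n}}\int_{\mathbb{R}^{n}}|K_{\varphi}(\xi+m,\eta)|^{2}d\eta$ for $\xi\in\mathbb{R}^{n}$; this is $\mathbb{Z}^{n}$-periodic and is regarded also as a function on $\mathbb{T}^{n}$; $1/w_\varphi$ is $+\infty$ where $w_\varphi=0$. Condition C: $\varphi$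 satisfies condition C if for every $l\in\mathbb{Z}^{n}\setminus\{0\}$, $\sum_{m\in\mathbb{Z}^{n}}\int_{\mathbb{R}^{n}}K_{\varphi}(\xi+m,\eta)\overline{K_{\varphi}(\xi+m+l,\eta)}\,d\eta=0$ for a.e. $\xi\in\mathbb{T}^{n}$. A family $\{f_{j}:j\in\mathbb{Z}^{d}\}$ in a Hilbert space $\mathcal{H}$ is Hilbertian if $\{c_{j}\}\in\ell^{2}(\mathbb{Z}^{d})$ implies that $\sum_{j\in\mathbb{Z}^{d}}c_{j}f_{j}$ converges. Convergence of a series over $\mathbb{Z}^{d}$ means norm convergence in $\mathcal{H}$ of the partial sums over $\{j:\max_i|j_i|\le N\}$ as $N\to\infty$. *)

theory Defs
  imports "HOL-Probability.Essential_Supremum"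
begin

text \<open>Elements of the space \<open>L\<^sup>2\<close> of a measure are represented by measurable functions rather than by
  equivalence classes; over \<^const>\<open>lborel\<close> these are Borel representatives.\<close>

definition L2_space :: "'a measure \<Rightarrow> ('a \<Rightarrow> complex) set" where
  "L2_space M = {f \<in> borel_measurable M. (\<integral>\<^sup>+x. ennreal ((cmod (f x))\<^sup>2) \<partial>M) < \<infinity>}"

definition L2_tendsto :: "'a measure \<Rightarrow> (nat \<Rightarrow> 'a \<Rightarrow> complex) \<Rightarrow> ('a \<Rightarrow> complex) \<Rightarrow> bool" where
  "L2_tendsto M F f \<longleftrightarrow> (\<lambda>N. \<integral>\<^sup>+x. ennreal ((cmod (F N x - f x))\<^sup>2) \<partial>M) \<longlonglongrightarrow> 0"

definition int_box :: "nat \<Rightarrow> (int ^ 'd) set" where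
  "int_box N = {j. \<forall>i. \<bar>j $ i\<bar> \<le> int N}"

definition hilbertian_L2 :: "'a measure \<Rightarrow> (int ^ 'd \<Rightarrow> 'a \<Rightarrow> complex) \<Rightarrow> bool" where
  "hilbertian_L2 M f \<longleftrightarrow>
     (\<forall>j. f j \<in> L2_space M) \<and>
     (\<forall>c. (\<lambda>j. (cmod (c j))\<^sup>2) summable_on UNIV \<longrightarrow>
        (\<exists>g \<in> L2_space M. L2_tendsto M (\<lambda>N x. \<Sum>j\<in>int_box N. c j * f j x) g))"

definition real_vec :: "int ^ 'n \<Rightarrow> real ^ 'n" where
  "real_vec k = (\<chi> i. real_of_int (k $ i))"

definition twisted_translation ::
    "int ^ 'n \<Rightarrow> int ^ 'n \<Rightarrow> ((real ^ 'n) \<times> (real ^ 'n) \<Rightarrow> complex) \<Rightarrow> (real ^ 'n) \<times> (real ^ 'n) \<Rightarrow> complex" where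
  "twisted_translation k l \<phi> =
     (\<lambda>(x, y). exp (of_real pi * \<i> * of_real (x \<bullet> real_vec l - y \<bullet> real_vec k))
                 * \<phi> (x - real_vec k, y - real_vec l))"

text \<open>The kernel of the Weyl transform is the limit in \<open>L\<^sup>2\<close> of the integrals over balls of growing
  radius.  It is determined only almost everywhere; \<open>weyl_kernel f\<close> is some Borel representative.\<close>

definition truncated_weyl_kernel ::
    "nat \<Rightarrow> ((real ^ 'n) \<times> (real ^ 'n) \<Rightarrow> complex) \<Rightarrow> (real ^ 'n) \<times> (real ^ 'n) \<Rightarrow> complex" where
  "truncated_weyl_kernel N f =
     (\<lambda>(\<xi>, \<eta>). LINT x:ball 0 (real N)|lborel.
        f (x, \<eta> - \<xi>) * exp (\<i> * of_real pi * of_real (x \<bullet> (\<xi> + \<eta>))))"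

definition is_weyl_kernel ::
    "((real ^ 'n) \<times> (real ^ 'n) \<Rightarrow> complex) \<Rightarrow> ((real ^ 'n) \<times> (real ^ 'n) \<Rightarrow> complex) \<Rightarrow> bool" where
  "is_weyl_kernel f K \<longleftrightarrow>
     K \<in> L2_space lborel \<and> L2_tendsto lborel (\<lambda>N. truncated_weyl_kernel N f) K"

definition weyl_kernel ::
    "((real ^ 'n) \<times> (real ^ 'n) \<Rightarrow> complex) \<Rightarrow> (real ^ 'n) \<times> (real ^ 'n) \<Rightarrow> complex" where
  "weyl_kernel f = (SOME K. is_weyl_kernel f K)"

text \<open>The values are extended reals, so \<open>1 / w_fun \<phi> \<xi> = \<infinity>\<close> where \<open>w_fun \<phi> \<xi> = 0\<close>.\<close>

definition w_fun :: "((real ^ 'n) \<times> (real ^ 'n) \<Rightarrow> complex) \<Rightarrow> real ^ 'n \<Rightarrow> ennreal" where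
  "w_fun \<phi> \<xi> = (\<Sum>\<^sub>\<infinity>m::int ^ 'n. \<integral>\<^sup>+\<eta>. ennreal ((cmod (weyl_kernel \<phi> (\<xi> + real_vec m, \<eta>)))\<^sup>2) \<partial>lborel)"

definition torus :: "(real ^ 'n) measure" where
  "torus = restrict_space lborel {\<xi>. \<forall>i. 0 \<le> \<xi> $ i \<and> \<xi> $ i < 1}"

text \<open>For \<open>\<phi>\<close> in \<open>L\<^sup>2\<close>, the integrals and the series below converge absolutely for almost every \<open>\<xi>\<close>.\<close>

definition condition_C :: "((real ^ 'n) \<times> (real ^ 'n) \<Rightarrow> complex) \<Rightarrow> bool" where
  "condition_C \<phi> \<longleftrightarrow>
     (\<forall>l::int ^ 'n. l \<noteq> 0 \<longrightarrow>
        (AE \<xi> in torus.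
           ((\<lambda>m::int ^ 'n. LINT \<eta>|lborel.
               weyl_kernel \<phi> (\<xi> + real_vec m, \<eta>)
                 * cnj (weyl_kernel \<phi> (\<xi> + real_vec m + real_vec l, \<eta>))) has_sum 0) UNIV))"

end

theory Submission
  imports Defs "HOL-Probability.Probability_Measure"
begin

text \<open>
  The Weyl transform turns the twisted translation by \<open>(k, 0)\<close> into a modulation: the kernel of the
  translate of \<open>\<phi>\<close> is \<open>exp (2 \<pi> i k \<bullet> \<xi>) K\<^sub>\<phi>(\<xi>, \<eta>)\<close>.  A finite combination of these translates with coefficients \<open>c\<^sub>k\<close>
  therefore has the kernel \<open>P(\<xi>) K\<^sub>\<phi>(\<xi>, \<eta>)\<close>, where \<open>P\<close> is the trigonometric polynomial with the same
  coefficients.  Since \<open>P\<close> is periodic, folding the \<open>\<xi>\<close>-axis onto the torus gives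
  \<open>\<parallel>P K\<^sub>\<phi>\<parallel>\<^sup>2 = \<integral> |P|\<^sup>2 w\<^sub>\<phi>\<close> (lemma \<open>nn_integral_torus_times_w_fun\<close>).

  Boundedness enters through the uniform boundedness principle: convergence of \<open>\<Sum> c\<^sub>j f\<^sub>j\<close> for all
  square-summable \<open>c\<close> forces \<open>\<parallel>\<Sum> c\<^sub>j f\<^sub>j\<parallel>\<^sup>2 \<le> B \<Sum> |c\<^sub>j|\<^sup>2\<close> with one \<open>B\<close> for all finite sums
  (lemma \<open>hilbertian_bound\<close>).  For the modulations this says \<open>\<integral> |P|\<^sup>2 w\<^sub>\<phi> \<le> B \<integral> |P|\<^sup>2\<close> for every
  trigonometric polynomial \<open>P\<close>.  Trigonometric polynomials approximate continuous functions on the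
  torus uniformly, continuous functions approximate indicators of open sets, and open sets
  approximate Borel sets from outside; hence \<open>\<integral>\<^sub>A w\<^sub>\<phi> \<le> B |A|\<close> for all Borel sets \<open>A\<close>, that is
  \<open>w\<^sub>\<phi> \<le> B\<close> almost everywhere (lemma \<open>AE_le_of_trig_bound\<close>).

  The kernel is chosen among the \<open>L\<^sup>2\<close> limits of truncated integrals, so its existence has to be shown
  before any of its properties are available.  Both the existence and the comparison
  \<open>\<parallel>P K\<^sub>\<phi>\<parallel> \<le> \<parallel>\<Sum> c\<^sub>k T\<^sub>k \<phi>\<parallel>\<close> follow from the estimate \<open>\<parallel>F g\<parallel> \<le> \<parallel>g\<parallel>\<close> for the Fourier transform \<open>F\<close> on functions
  of bounded support (lemma \<open>sqnorm_fourier_le\<close>), which is Bessel's inequality for shifted characters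
  of a cube, averaged over the shifts.
\<close>

section \<open>Square-integrable functions\<close>

text \<open>The squared norm with values in the extended reals, so that no integrability is presupposed.\<close>

definition sqnorm :: "'a measure \<Rightarrow> ('a \<Rightarrow> complex) \<Rightarrow> ennreal" where
  "sqnorm M f = (\<integral>\<^sup>+x. ennreal ((cmod (f x))\<^sup>2) \<partial>M)"

lemma L2_space_iff: "f \<in> L2_space M \<longleftrightarrow> f \<in> borel_measurable M \<and> sqnorm M f < \<infinity>"
  by (simp add: L2_space_def sqnorm_def)

lemma L2_tendsto_iff: "L2_tendsto M F f \<longleftrightarrow> (\<lambda>N. sqnorm M (\<lambda>x. F N x - f x)) \<longlonglongrightarrow> 0"
  by (simp add: L2_tendsto_def sqnorm_def)

lemma ennreal_le_2_sum: 
  assumes "(a::real) \<le> 2 * b + 2 * c" "0 \<le> b" "0 \<le> c"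
  shows "ennreal a \<le> 2 * ennreal b + 2 * ennreal c"
proof -
  have "ennreal a \<le> ennreal (2 * b + 2 * c)" using assms by (intro ennreal_leI)
  also have "\<dots> = 2 * ennreal b + 2 * ennreal c"
    using assms by (simp add: ennreal_plus ennreal_mult')
  finally show ?thesis .
qed

lemma cmod_add_sq_le: "(cmod (a + b))\<^sup>2 \<le> 2 * (cmod a)\<^sup>2 + 2 * (cmod b)\<^sup>2"
proof -
  have "(cmod (a + b))\<^sup>2 \<le> (cmod a + cmod b)\<^sup>2"
    by (intro power_mono norm_triangle_ineq) auto
  also have "\<dots> \<le> 2 * (cmod a)\<^sup>2 + 2 * (cmod b)\<^sup>2"
    using sum_squares_bound[of "cmod a" "cmod b"] by (simp add: power2_sum)
  finally show ?thesis .
qed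

lemma sqnorm_add_le:
  assumes [measurable]: "f \<in> borel_measurable M" "g \<in> borel_measurable M"
  shows "sqnorm M (\<lambda>x. f x + g x) \<le> 2 * sqnorm M f + 2 * sqnorm M g"
proof -
  have "sqnorm M (\<lambda>x. f x + g x)
      \<le> (\<integral>\<^sup>+x. 2 * ennreal ((cmod (f x))\<^sup>2) + 2 * ennreal ((cmod (g x))\<^sup>2) \<partial>M)"
    unfolding sqnorm_def by (intro nn_integral_mono ennreal_le_2_sum cmod_add_sq_le) auto
  also have "\<dots> = 2 * sqnorm M f + 2 * sqnorm M g"
    unfolding sqnorm_def by (simp add: nn_integral_add nn_integral_cmult)
  finally show ?thesis .
qed

lemma sqnorm_uminus: "sqnorm M (\<lambda>x. - f x) = sqnorm M f"
  by (simp add: sqnorm_def)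

lemma sqnorm_diff_le:
  assumes [measurable]: "f \<in> borel_measurable M" "g \<in> borel_measurable M"
  shows "sqnorm M (\<lambda>x. f x - g x) \<le> 2 * sqnorm M f + 2 * sqnorm M g"
  using sqnorm_add_le[of f M "\<lambda>x. - g x"] by (simp add: sqnorm_uminus)

lemma sqnorm_diff_le3:
  assumes [measurable]: "f \<in> borel_measurable M" "g \<in> borel_measurable M" "h \<in> borel_measurable M"
  shows "sqnorm M (\<lambda>x. f x - g x) \<le> 2 * sqnorm M (\<lambda>x. f x - h x) + 2 * sqnorm M (\<lambda>x. g x - h x)"
  using sqnorm_diff_le[of "\<lambda>x. f x - h x" M "\<lambda>x. g x - h x"] by simp

lemma sqnorm_cmult:
  assumes [measurable]: "f \<in> borel_measurable M"
  shows "sqnorm M (\<lambda>x. c * f x) = ennreal ((cmod c)\<^sup>2) * sqnorm M f"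
  by (simp add: sqnorm_def norm_mult power_mult_distrib ennreal_mult nn_integral_cmult)

lemma cmod_sum_sq_le: "(cmod (\<Sum>j\<in>F. a j))\<^sup>2 \<le> real (card F) * (\<Sum>j\<in>F. (cmod (a j))\<^sup>2)"
proof -
  have "(cmod (\<Sum>j\<in>F. a j))\<^sup>2 \<le> (\<Sum>j\<in>F. cmod (a j))\<^sup>2"
    by (intro power_mono norm_sum) auto
  also have "\<dots> \<le> (\<Sum>j\<in>F. (cmod (a j))\<^sup>2) * (\<Sum>j\<in>F. 1\<^sup>2)"
    using Cauchy_Schwarz_ineq_sum[of "\<lambda>j. cmod (a j)" "\<lambda>_. 1" F] by simp
  finally show ?thesis by (simp add: mult.commute)
qed

lemma sqnorm_sum_finite:
  assumes "\<And>j. j \<in> F \<Longrightarrow> f j \<in> L2_space M" "finite F"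
  shows "(\<lambda>x. \<Sum>j\<in>F. c j * f j x) \<in> L2_space M"
  using assms(2,1)
proof (induction F rule: finite_induct)
  case empty
  then show ?case by (simp add: L2_space_iff sqnorm_def)
next
  case (insert k F)
  have k: "f k \<in> borel_measurable M" "sqnorm M (f k) < \<infinity>"
    and F: "(\<lambda>x. \<Sum>j\<in>F. c j * f j x) \<in> borel_measurable M" "sqnorm M (\<lambda>x. \<Sum>j\<in>F. c j * f j x) < \<infinity>"
    using insert by (auto simp: L2_space_iff)
  have "sqnorm M (\<lambda>x. c k * f k x + (\<Sum>j\<in>F. c j * f j x))
     \<le> 2 * sqnorm M (\<lambda>x. c k * f k x) + 2 * sqnorm M (\<lambda>x. \<Sum>j\<in>F. c j * f j x)"
    using k F by (intro sqnorm_add_le) auto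
  also have "\<dots> < \<infinity>"
    using k F by (simp add: sqnorm_cmult ennreal_mult_less_top)
  finally show ?case
    using insert k F by (auto simp: L2_space_iff intro!: borel_measurable_add borel_measurable_times)
qed

text \<open>
  By the Cauchy--Schwarz inequality at each point; in particular every finite subfamily satisfies a
  bound of the Hilbertian kind.
\<close>

lemma sqnorm_sum_le_coeffs:
  assumes "\<And>j. j \<in> F \<Longrightarrow> f j \<in> borel_measurable M" "finite F"
  shows "sqnorm M (\<lambda>x. \<Sum>j\<in>F. c j * f j x)
    \<le> (\<Sum>j\<in>F. sqnorm M (f j)) * ennreal (\<Sum>j\<in>F. (cmod (c j))\<^sup>2)"
proof -
  have *: "(cmod (\<Sum>j\<in>F. c j * f j x))\<^sup>2 \<le> (\<Sum>j\<in>F. (cmod (f j x))\<^sup>2) * (\<Sum>j\<in>F. (cmod (c j))\<^sup>2)" for x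
  proof -
    have "(cmod (\<Sum>j\<in>F. c j * f j x))\<^sup>2 \<le> (\<Sum>j\<in>F. cmod (f j x) * cmod (c j))\<^sup>2"
      by (intro power_mono order_trans[OF norm_sum]) (auto simp: norm_mult mult.commute)
    also have "\<dots> \<le> (\<Sum>j\<in>F. (cmod (f j x))\<^sup>2) * (\<Sum>j\<in>F. (cmod (c j))\<^sup>2)"
      by (rule Cauchy_Schwarz_ineq_sum)
    finally show ?thesis .
  qed
  have "sqnorm M (\<lambda>x. \<Sum>j\<in>F. c j * f j x)
      \<le> (\<integral>\<^sup>+x. (\<Sum>j\<in>F. ennreal ((cmod (f j x))\<^sup>2)) * ennreal (\<Sum>j\<in>F. (cmod (c j))\<^sup>2) \<partial>M)"
    unfolding sqnorm_def
    by (intro nn_integral_mono order_trans[OF ennreal_leI[OF *]])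
       (simp add: ennreal_mult sum_nonneg)
  also have "\<dots> = (\<Sum>j\<in>F. sqnorm M (f j)) * ennreal (\<Sum>j\<in>F. (cmod (c j))\<^sup>2)"
    using assms unfolding sqnorm_def
    by (subst nn_integral_multc, measurable) (subst nn_integral_sum, auto)
  finally show ?thesis .
qed

text \<open>
  Young's inequality \<open>|u|\<^sup>2 \<le> (1 + d) |v|\<^sup>2 + (1 + 1/d) |v - u|\<^sup>2\<close> compares the two norms;
  let first \<open>N\<close> tend to infinity and then \<open>d\<close> to zero.
\<close>

lemma sqnorm_limit_le:
  assumes [measurable]: "\<And>N. F N \<in> borel_measurable M" "f \<in> borel_measurable M"
    and lim: "L2_tendsto M F f" and le: "\<And>N. sqnorm M (F N) \<le> a N" and a: "a \<longlonglongrightarrow> b"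
  shows "sqnorm M f \<le> b"
proof -
  have main: "sqnorm M f \<le> ennreal (1 + d) * b" if d: "d > 0" for d :: real
  proof -
    have pt: "(cmod u)\<^sup>2 \<le> (1 + d) * (cmod v)\<^sup>2 + (1 + 1/d) * (cmod (v - u))\<^sup>2" for u v
    proof -
      have "cmod u \<le> cmod v + cmod (v - u)"
        using norm_triangle_ineq4[of v "v - u"] by simp
      then have "(cmod u)\<^sup>2 \<le> (cmod v + cmod (v - u))\<^sup>2" by (intro power_mono) auto
      moreover have "0 \<le> (d * cmod v - cmod (v - u))\<^sup>2 / d" using d by simp
      moreover have "(d * cmod v - cmod (v - u))\<^sup>2 / d
         = d * (cmod v)\<^sup>2 - 2 * cmod v * cmod (v-u) + (1/d) * (cmod (v-u))\<^sup>2"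
        using d by (simp add: power2_eq_square field_simps)
      ultimately show ?thesis by (simp add: power2_sum algebra_simps)
    qed
    have "sqnorm M f \<le> ennreal (1 + d) * a N + ennreal (1 + 1/d) * sqnorm M (\<lambda>x. F N x - f x)" for N
    proof -
      have "sqnorm M f \<le> (\<integral>\<^sup>+x. ennreal (1 + d) * ennreal ((cmod (F N x))\<^sup>2)
               + ennreal (1 + 1/d) * ennreal ((cmod (F N x - f x))\<^sup>2) \<partial>M)"
        unfolding sqnorm_def using d
        by (intro nn_integral_mono order_trans[OF ennreal_leI[OF pt]])
           (auto simp: ennreal_plus ennreal_mult)
      also have "\<dots> = ennreal (1 + d) * sqnorm M (F N) + ennreal (1 + 1/d) * sqnorm M (\<lambda>x. F N x - f x)"
        unfolding sqnorm_def by (simp add: nn_integral_add nn_integral_cmult)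
      finally show ?thesis
        using le[of N] by (meson add_right_mono dual_order.trans mult_left_mono zero_le)
    qed
    moreover have "(\<lambda>N. ennreal (1 + d) * a N + ennreal (1 + 1/d) * sqnorm M (\<lambda>x. F N x - f x))
       \<longlonglongrightarrow> ennreal (1 + d) * b + ennreal (1 + 1/d) * 0"
      using lim a unfolding L2_tendsto_iff
      by (intro tendsto_add ennreal_tendsto_cmult) auto
    ultimately show ?thesis
      by (intro LIMSEQ_le_const[of _ _ "sqnorm M f"]) auto
  qed
  have "(\<lambda>n. ennreal (1 + 1 / real (Suc n)) * b) \<longlonglongrightarrow> ennreal 1 * b"
  proof -
    have "(\<lambda>n. 1 + 1 / real (Suc n)) \<longlonglongrightarrow> 1 + 0"
      by (intro tendsto_intros LIMSEQ_Suc[OF lim_const_over_n])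
    then have "(\<lambda>n. ennreal (1 + 1 / real (Suc n))) \<longlonglongrightarrow> ennreal (1 + 0)"
      by (intro tendsto_ennrealI)
    then show ?thesis
      by (intro tendsto_mult_ennreal tendsto_const) auto
  qed
  then have "(\<lambda>n. ennreal (1 + 1 / real (Suc n)) * b) \<longlonglongrightarrow> b" by simp
  then show ?thesis
  proof (rule LIMSEQ_le_const[where a = "sqnorm M f"])
    show "\<exists>N. \<forall>n\<ge>N. sqnorm M f \<le> ennreal (1 + 1 / real (Suc n)) * b"
      by (intro exI allI impI main) auto
  qed
qed

text \<open>
  Riesz--Fischer: along a subsequence with geometrically decreasing increments the functions
  converge almost everywhere, and Fatou's lemma turns the pointwise limit into a limit in \<open>L\<^sup>2\<close>.
\<close>

lemma L2_complete:
  assumes [measurable]: "\<And>N. F N \<in> borel_measurable M"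
    and L2: "\<And>N. sqnorm M (F N) < \<infinity>"
    and cauchy: "\<And>e::real. e > 0 \<Longrightarrow> \<exists>N0. \<forall>m\<ge>N0. \<forall>n\<ge>N0. sqnorm M (\<lambda>x. F m x - F n x) \<le> ennreal e"
  shows "\<exists>f\<in>L2_space M. L2_tendsto M F f"
proof -
  have "\<exists>N0. \<forall>m\<ge>N0. \<forall>n\<ge>N0. sqnorm M (\<lambda>x. F m x - F n x) \<le> ennreal ((1/4)^k)" for k :: nat
    by (rule cauchy) simp
  then obtain s0 where s0: "\<And>k m n. m \<ge> s0 k \<Longrightarrow> n \<ge> s0 k \<Longrightarrow> sqnorm M (\<lambda>x. F m x - F n x) \<le> ennreal ((1/4)^k)"
    by metis
  define s where "s k = (\<Sum>i\<le>k. s0 i + i)" for k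
  have s_ge: "s k \<ge> s0 k + k" for k
    unfolding s_def using member_le_sum[of k "{..k}" "\<lambda>i. s0 i + i"] by simp
  have s_mono: "s j \<le> s k" if "j \<le> k" for j k
    unfolding s_def using that by (intro sum_mono2) auto
  have d: "sqnorm M (\<lambda>x. F (s (Suc k)) x - F (s k) x) \<le> ennreal ((1/4)^k)" for k
    by (rule s0) (use s_ge[of k] s_mono[of k "Suc k"] in linarith)+
  define D where "D k x = F (s (Suc k)) x - F (s k) x" for k x
  have [measurable]: "D k \<in> borel_measurable M" for k unfolding D_def by measurable
  \<comment> \<open>The weights \<open>2^k\<close> make the increments summable at almost every point.\<close>
  have "(\<integral>\<^sup>+x. (\<Sum>k. ennreal (2^k * (cmod (D k x))\<^sup>2)) \<partial>M) = (\<Sum>k. \<integral>\<^sup>+x. ennreal (2^k * (cmod (D k x))\<^sup>2) \<partial>M)"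
    by (rule nn_integral_suminf) measurable
  also have "\<dots> \<le> (\<Sum>k. ennreal ((1/2)^k))"
  proof (intro suminf_le)
    fix k
    have "(\<integral>\<^sup>+x. ennreal (2^k * (cmod (D k x))\<^sup>2) \<partial>M) = ennreal (2^k) * sqnorm M (D k)"
      unfolding sqnorm_def by (simp add: ennreal_mult nn_integral_cmult)
    also have "\<dots> \<le> ennreal (2^k) * ennreal ((1/4)^k)"
      using d[of k] unfolding D_def by (intro mult_left_mono) auto
    also have "\<dots> = ennreal ((1/2)^k)"
      by (simp add: ennreal_mult[symmetric] power_mult_distrib[symmetric])
    finally show "(\<integral>\<^sup>+x. ennreal (2^k * (cmod (D k x))\<^sup>2) \<partial>M) \<le> ennreal ((1/2)^k)" .
  qed auto
  also have "\<dots> = ennreal (\<Sum>k. (1/2)^k)"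
    by (intro suminf_ennreal2 summable_geometric) auto
  also have "\<dots> < \<infinity>" by simp
  finally have "(\<integral>\<^sup>+x. (\<Sum>k. ennreal (2^k * (cmod (D k x))\<^sup>2)) \<partial>M) \<noteq> \<infinity>" by simp
  then have "AE x in M. (\<Sum>k. ennreal (2^k * (cmod (D k x))\<^sup>2)) \<noteq> \<infinity>"
    by (intro nn_integral_PInf_AE) measurable
  then have conv: "AE x in M. convergent (\<lambda>k. F (s k) x)"
  proof eventually_elim
    case (elim x)
    define t where "t k = ennreal (2^k * (cmod (D k x))\<^sup>2)" for k
    define C where "C = enn2real (\<Sum>k. t k)"
    have "(\<Sum>k. t k) < top" using elim by (simp add: t_def[abs_def] less_top)
    then have C: "C \<ge> 0" "(\<Sum>k. t k) = ennreal C"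
      by (auto simp: C_def)
    have "cmod (D k x) \<le> sqrt C * (1 / sqrt 2)^k" for k
    proof -
      have "(\<Sum>i\<in>{k}. t i) \<le> (\<Sum>k. t k)"
        by (intro sum_le_suminf) auto
      then have "ennreal (2^k * (cmod (D k x))\<^sup>2) \<le> ennreal C" unfolding C by (simp add: t_def)
      then have "2^k * (cmod (D k x))\<^sup>2 \<le> C" using C(1) by (simp add: ennreal_le_iff)
      then have "(cmod (D k x))\<^sup>2 \<le> C * (1/2)^k" by (simp add: field_simps power_divide)
      also have "C * (1/2)^k = (sqrt C * (1 / sqrt 2)^k)\<^sup>2"
        using C(1) by (simp add: power_mult_distrib power_divide power_even_eq[symmetric])
                     (simp add: power_mult)
      finally show ?thesis
        using C(1) by (intro power2_le_imp_le[of "cmod (D k x)"]) auto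
    qed
    moreover have "summable (\<lambda>k. sqrt C * (1 / sqrt 2)^k)"
      by (intro summable_mult summable_geometric) auto
    ultimately have "summable (\<lambda>k. D k x)"
      by (intro summable_norm_cancel[of "\<lambda>k. D k x"] summable_comparison_test'[of "\<lambda>k. sqrt C * (1 / sqrt 2)^k" 0 "\<lambda>k. cmod (D k x)"]) auto
    then have "convergent (\<lambda>n. \<Sum>k<n. D k x)" by (simp add: summable_iff_convergent)
    then have "convergent (\<lambda>n. (\<Sum>k<n. D k x) + F (s 0) x)"
      by (intro convergent_add convergent_const)
    moreover have "(\<Sum>k<n. D k x) = F (s n) x - F (s 0) x" for n
      unfolding D_def by (rule sum_lessThan_telescope)
    ultimately show ?case by simp
  qed
  define f where "f x = lim (\<lambda>k. F (s k) x)" for x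
  have [measurable]: "f \<in> borel_measurable M" unfolding f_def by measurable
  have lim: "AE x in M. (\<lambda>k. F (s k) x) \<longlonglongrightarrow> f x"
    using conv by eventually_elim (simp add: f_def convergent_LIMSEQ_iff)
  have fatou: "sqnorm M (\<lambda>x. F n x - f x) \<le> ennreal e" if e: "e > 0"
    and N0: "\<forall>m\<ge>N0. \<forall>n\<ge>N0. sqnorm M (\<lambda>x. F m x - F n x) \<le> ennreal e" "n \<ge> N0" for e n N0
  proof -
    have "sqnorm M (\<lambda>x. F n x - f x) = (\<integral>\<^sup>+x. liminf (\<lambda>k. ennreal ((cmod (F n x - F (s k) x))\<^sup>2)) \<partial>M)"
      unfolding sqnorm_def
    proof (rule nn_integral_cong_AE)
      show "AE x in M. ennreal ((cmod (F n x - f x))\<^sup>2) = liminf (\<lambda>k. ennreal ((cmod (F n x - F (s k) x))\<^sup>2))"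
        using lim
      proof eventually_elim
        case (elim x)
        have "(\<lambda>k. ennreal ((cmod (F n x - F (s k) x))\<^sup>2)) \<longlonglongrightarrow> ennreal ((cmod (F n x - f x))\<^sup>2)"
          by (intro tendsto_ennrealI tendsto_intros elim)
        then show ?case by (intro lim_imp_Liminf[symmetric]) auto
      qed
    qed
    also have "\<dots> \<le> liminf (\<lambda>k. sqnorm M (\<lambda>x. F n x - F (s k) x))"
      unfolding sqnorm_def by (rule nn_integral_liminf) measurable
    also have "\<dots> \<le> ennreal e"
    proof (rule Liminf_le)
      show "\<forall>\<^sub>F k in sequentially. sqnorm M (\<lambda>x. F n x - F (s k) x) \<le> ennreal e"
        using eventually_ge_at_top[of N0]
      proof eventually_elim
        case (elim k) then show ?case using N0 s_ge[of k] by auto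
      qed
    qed simp
    finally show ?thesis .
  qed
  have "L2_tendsto M F f"
    unfolding L2_tendsto_iff
  proof (rule order_tendstoI)
    fix a :: ennreal assume "0 < a"
    then obtain e0 where e0: "0 < e0" "e0 < a" using dense by blast
    then obtain e where e: "0 < e" "ennreal e < a"
      by (cases e0 rule: ennreal_cases) auto
    obtain N0 where N0: "\<forall>m\<ge>N0. \<forall>n\<ge>N0. sqnorm M (\<lambda>x. F m x - F n x) \<le> ennreal e"
      using cauchy[OF e(1)] by blast
    show "\<forall>\<^sub>F n in sequentially. sqnorm M (\<lambda>x. F n x - f x) < a"
      using eventually_ge_at_top[of N0]
      by eventually_elim (use fatou[OF e(1) N0] e(2) in \<open>auto intro: le_less_trans\<close>)
  qed auto
  moreover have "sqnorm M f < \<infinity>"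
  proof -
    obtain N0 where N0: "\<forall>m\<ge>N0. \<forall>n\<ge>N0. sqnorm M (\<lambda>x. F m x - F n x) \<le> ennreal 1"
      using cauchy[of 1] by auto
    have "sqnorm M (\<lambda>x. F N0 x - (F N0 x - f x)) \<le> 2 * sqnorm M (F N0) + 2 * sqnorm M (\<lambda>x. F N0 x - f x)"
      by (rule sqnorm_diff_le) measurable
    also have "\<dots> \<le> 2 * sqnorm M (F N0) + 2 * ennreal 1"
      using fatou[OF _ N0, of N0] by (intro add_left_mono mult_left_mono) auto
    also have "\<dots> < \<infinity>" using L2[of N0] by (simp add: ennreal_mult_less_top)
    finally show ?thesis by simp
  qed
  ultimately show ?thesis by (auto simp: L2_space_iff)
qed

section \<open>Uniform boundedness for Hilbertian families\<close>

lemma finite_int_box: "finite (int_box N :: (int ^ 'd) set)"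
proof -
  have "int_box N \<subseteq> (\<lambda>f. \<chi> i. f i) ` (PiE (UNIV :: 'd set) (\<lambda>_. {- int N..int N}))"
  proof
    fix j :: "int ^ 'd" assume "j \<in> int_box N"
    then have "\<And>i. \<bar>j $ i\<bar> \<le> int N" by (auto simp: int_box_def)
    then have "\<And>i. - int N \<le> j $ i \<and> j $ i \<le> int N" by (metis abs_le_iff minus_le_iff)
    then have "(\<lambda>i. j $ i) \<in> PiE UNIV (\<lambda>_. {- int N..int N})" by auto
    moreover have "j = (\<chi> i. j $ i)" by (simp add: vec_eq_iff)
    ultimately show "j \<in> (\<lambda>f. \<chi> i. f i) ` (PiE (UNIV :: 'd set) (\<lambda>_. {- int N..int N}))" by (intro image_eqI[where x = "\<lambda>i. j $ i"])
  qed
  then show ?thesis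
    by (rule finite_subset) (intro finite_imageI finite_PiE, auto)
qed

lemma int_box_mono: "m \<le> n \<Longrightarrow> int_box m \<subseteq> int_box n"
  unfolding int_box_def by (auto intro: order_trans)

lemma sum_int_box_split:
  "m \<le> n \<Longrightarrow> sum h (int_box n) = sum h (int_box m) + sum h (int_box n - int_box m)"
  using sum.subset_diff[OF int_box_mono finite_int_box, of m n h] by (simp add: add.commute)

lemma finite_subset_int_box:
  assumes "finite (F :: (int ^ 'd) set)"
  shows "\<exists>N\<ge>m. F \<subseteq> int_box N"
proof -
  define N where "N = (\<Sum>j\<in>F. \<Sum>i\<in>UNIV. nat \<bar>j $ i\<bar>)"
  have "\<bar>j $ i\<bar> \<le> int (max m N)" if "j \<in> F" for j i
  proof -
    have "nat \<bar>j $ i\<bar> \<le> (\<Sum>i\<in>UNIV. nat \<bar>j $ i\<bar>)" by (intro member_le_sum) auto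
    also have "\<dots> \<le> N" unfolding N_def using that assms by (intro member_le_sum[of j F "\<lambda>j. \<Sum>i\<in>UNIV. nat \<bar>j $ i\<bar>"]) auto
    finally show ?thesis by linarith
  qed
  then have "F \<subseteq> int_box (max m N)" by (auto simp: int_box_def)
  then show ?thesis by (intro exI[of _ "max m N"]) auto
qed

text \<open>
  The uniform boundedness principle, by a gliding hump.  If no bound exists then none exists for
  vectors with index outside a given box either.  This yields coefficient blocks on disjoint shells
  whose \<open>\<ell>\<^sup>2\<close> norms decay geometrically while the combinations have norm 1.  The blocks add up to a
  square-summable family whose series is not Cauchy.
\<close>

lemma hilbertian_bound:
  fixes f :: "int ^ 'd \<Rightarrow> 'a \<Rightarrow> complex"
  assumes H: "hilbertian_L2 M f"
  shows "\<exists>B\<ge>0. \<forall>F c. finite F \<longrightarrow>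
    sqnorm M (\<lambda>x. \<Sum>j\<in>F. c j * f j x) \<le> ennreal (B * (\<Sum>j\<in>F. (cmod (c j))\<^sup>2))"
proof (rule ccontr)
  assume unbounded: "\<not> ?thesis"
  have L2: "f j \<in> L2_space M" for j using H by (auto simp: hilbertian_L2_def)
  then have [measurable]: "f j \<in> borel_measurable M" for j by (auto simp: L2_space_iff)
  define q where "q c F = (\<Sum>j\<in>F. (cmod (c j))\<^sup>2)" for c :: "int ^ 'd \<Rightarrow> complex" and F
  define S where "S c F x = (\<Sum>j\<in>F. c j * f j x)" for c F x
  have [measurable]: "S c F \<in> borel_measurable M" for c F unfolding S_def by measurable
  have q_nonneg: "0 \<le> q c F" for c F by (simp add: q_def sum_nonneg)
  \<comment> \<open>A bound on the tails would give a bound, because finitely many vectors are always bounded.\<close>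
  have tail: "\<exists>N1 c. sqnorm M (S c (int_box N1 - int_box N0)) > ennreal (B * q c (int_box N1 - int_box N0))"
    if B: "B \<ge> 0" for N0 B
  proof (rule ccontr)
    assume neg: "\<not> ?thesis"
    define C where "C = (\<Sum>j\<in>int_box N0. enn2real (sqnorm M (f j)))"
    have C: "C \<ge> 0" by (simp add: C_def sum_nonneg)
    have C_eq: "(\<Sum>j\<in>int_box N0. sqnorm M (f j)) = ennreal C"
      using L2 unfolding C_def by (simp add: L2_space_iff flip: sum_ennreal)
    have "sqnorm M (\<lambda>x. \<Sum>j\<in>F. c j * f j x) \<le> ennreal (2 * (C + B) * (\<Sum>j\<in>F. (cmod (c j))\<^sup>2))"
      if F: "finite F" for F c
    proof -
      obtain N1 where N1: "N0 \<le> N1" "F \<subseteq> int_box N1" using finite_subset_int_box[OF F, of N0] by blast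
      let ?G = "int_box N1 - int_box N0 :: (int ^ 'd) set"
      define e where "e j = (if j \<in> F then c j else 0)" for j
      have "(\<Sum>j\<in>F. c j * f j x) = S e (int_box N0) x + S e ?G x" for x
      proof -
        have "(\<Sum>j\<in>F. c j * f j x) = S e (int_box N1) x"
          unfolding S_def using N1 by (intro sum.mono_neutral_cong_left finite_int_box) (auto simp: e_def)
        also have "\<dots> = S e (int_box N0) x + S e ?G x"
          unfolding S_def by (subst sum_int_box_split[OF N1(1)]) simp
        finally show ?thesis .
      qed
      then have "sqnorm M (\<lambda>x. \<Sum>j\<in>F. c j * f j x) = sqnorm M (\<lambda>x. S e (int_box N0) x + S e ?G x)" by simp
      also have "\<dots> \<le> 2 * sqnorm M (S e (int_box N0)) + 2 * sqnorm M (S e ?G)"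
        by (rule sqnorm_add_le) measurable
      also have "\<dots> \<le> 2 * (ennreal C * ennreal (q e (int_box N0))) + 2 * ennreal (B * q e ?G)"
      proof (intro add_mono mult_left_mono)
        show "sqnorm M (S e (int_box N0)) \<le> ennreal C * ennreal (q e (int_box N0))"
          unfolding C_eq[symmetric] S_def q_def by (rule sqnorm_sum_le_coeffs) (auto simp: finite_int_box)
        show "sqnorm M (S e ?G) \<le> ennreal (B * q e ?G)" using neg by (auto simp: not_less)
      qed auto
      also have "\<dots> = ennreal (2 * (C * q e (int_box N0)) + 2 * (B * q e ?G))"
        using C B q_nonneg by (simp add: ennreal_plus ennreal_mult)
      also have "\<dots> \<le> ennreal (2 * (C + B) * (q e (int_box N0) + q e ?G))"
        using C B q_nonneg[of e ?G] q_nonneg[of e "int_box N0"] by (intro ennreal_leI) (simp add: algebra_simps)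
      also have "q e (int_box N0) + q e ?G = q e (int_box N1)"
        unfolding q_def by (subst sum_int_box_split[OF N1(1)]) simp
      also have "q e (int_box N1) = (\<Sum>j\<in>F. (cmod (c j))\<^sup>2)"
        unfolding q_def using N1 by (intro sum.mono_neutral_cong_right finite_int_box) (auto simp: e_def)
      finally show ?thesis .
    qed
    moreover have "0 \<le> 2 * (C + B)" using C B by simp
    ultimately show False using unbounded by blast
  qed
  have hump: "\<exists>N1 c. N1 > N0 \<and> sqnorm M (S c (int_box N1 - int_box N0)) = 1
      \<and> q c (int_box N1 - int_box N0) \<le> (1/2)^i" for N0 i
  proof -
    obtain N1 c where c: "sqnorm M (S c (int_box N1 - int_box N0)) > ennreal (2^i * q c (int_box N1 - int_box N0))"
      using tail[of "2^i" N0] by auto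
    let ?G = "int_box N1 - int_box N0 :: (int ^ 'd) set"
    have "N1 > N0"
    proof (rule ccontr)
      assume "\<not> N1 > N0"
      then have empty: "?G = {}" using int_box_mono[of N1 N0] by auto
      have "sqnorm M (S c ?G) = 0" unfolding empty by (simp add: S_def sqnorm_def)
      with c show False by simp
    qed
    moreover
    have "S c ?G \<in> L2_space M"
      unfolding S_def using L2 finite_int_box by (intro sqnorm_sum_finite) auto
    then have "sqnorm M (S c ?G) \<noteq> top" by (simp add: L2_space_iff less_top)
    then obtain v where v: "v \<ge> 0" "sqnorm M (S c ?G) = ennreal v"
      by (cases "sqnorm M (S c ?G)" rule: ennreal_cases) auto
    have lt: "2^i * q c ?G < v" using c v q_nonneg by (simp add: ennreal_less_iff)
    then have v_pos: "v > 0" using q_nonneg[of c ?G] by (meson le_less_trans mult_nonneg_nonneg zero_le_numeral zero_le_power)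
    \<comment> \<open>Normalize so that the combination has norm 1.\<close>
    define s where "s = complex_of_real (1 / sqrt v)"
    have s: "(cmod s)\<^sup>2 = 1 / v"
      using v_pos by (simp add: s_def norm_divide power_divide)
    have "S (\<lambda>j. s * c j) ?G = (\<lambda>x. s * S c ?G x)"
      by (auto simp: S_def sum_distrib_left mult.assoc)
    then have "sqnorm M (S (\<lambda>j. s * c j) ?G) = 1"
      using v_pos v(2) by (simp add: sqnorm_cmult s flip: ennreal_mult)
    moreover have "q (\<lambda>j. s * c j) ?G = q c ?G / v"
      by (simp add: q_def norm_mult power_mult_distrib s sum_divide_distrib)
    moreover have "q c ?G / v \<le> (1/2)^i"
      using lt v_pos by (simp add: field_simps power_divide)
    ultimately show ?thesis by metis
  qed
  obtain N' where "\<forall>n i. \<exists>c. N' n i > n \<and> sqnorm M (S c (int_box (N' n i) - int_box n)) = 1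
      \<and> q c (int_box (N' n i) - int_box n) \<le> (1/2)^i" using hump by metis
  then obtain c' where c': "\<And>n i. N' n i > n" "\<And>n i. sqnorm M (S (c' n i) (int_box (N' n i) - int_box n)) = 1"
    "\<And>n i. q (c' n i) (int_box (N' n i) - int_box n) \<le> (1/2)^i" by metis
  define n where "n = rec_nat 0 (\<lambda>i m. N' m i)"
  have n_Suc: "n (Suc i) = N' (n i) i" for i by (simp add: n_def)
  have n_less: "n i < n (Suc i)" for i using c'(1) by (simp add: n_Suc)
  then have n_mono: "strict_mono n" by (rule strict_mono_Suc_iff[THEN iffD2, rule_format])
  define G where "G i = (int_box (n (Suc i)) - int_box (n i) :: (int ^ 'd) set)" for i
  have finG: "finite (G i)" for i by (simp add: G_def finite_int_box)
  have disj: "i = k" if "j \<in> G i" "j \<in> G k" for i k j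
  proof -
    have *: False if "j \<in> G i" "j \<in> G k" "i < k" for i k
      using that int_box_mono[of "n (Suc i)" "n k"] n_mono[THEN strict_mono_less_eq, of "Suc i" k]
      by (auto simp: G_def)
    show ?thesis using * that by (metis nat_neq_iff)
  qed
  \<comment> \<open>The shells \<open>G i\<close> are disjoint, so the blocks can be glued together.\<close>
  define c where "c j = (if \<exists>i. j \<in> G i then c' (n (THE i. j \<in> G i)) (THE i. j \<in> G i) j else 0)" for j
  have c_eq: "c j = c' (n i) i j" if "j \<in> G i" for i j
  proof -
    have "(THE i. j \<in> G i) = i" using disj that by blast
    then show ?thesis using that by (auto simp: c_def)
  qed
  have qG: "q c (G i) \<le> (1/2)^i" for i
  proof -
    have "q c (G i) = q (c' (n i) i) (G i)" unfolding q_def by (intro sum.cong) (auto simp: c_eq)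
    then show ?thesis using c'(3)[of "n i" i] by (simp add: G_def n_Suc)
  qed
  have SG: "sqnorm M (S c (G i)) = 1" for i
  proof -
    have "S c (G i) = S (c' (n i) i) (G i)" unfolding S_def by (intro ext sum.cong) (auto simp: c_eq)
    then show ?thesis using c'(2)[of "n i" i] by (simp add: G_def n_Suc)
  qed
  have "q c (int_box (n i)) \<le> (\<Sum>k<i. (1/2)^k)" for i
  proof (induction i)
    case 0
    have "c j = 0" if "j \<in> int_box (n 0)" for j
    proof -
      have "j \<notin> G i" for i
        using that int_box_mono[of "n 0" "n i"] n_mono[THEN strict_mono_less_eq, of 0 i] by (auto simp: G_def)
      then show ?thesis by (simp add: c_def)
    qed
    then show ?case by (simp add: q_def)
  next
    case (Suc i)
    have "q c (int_box (n (Suc i))) = q c (int_box (n i)) + q c (G i)"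
      unfolding q_def G_def by (rule sum_int_box_split[OF less_imp_le[OF n_less]])
    then show ?case using Suc qG[of i] by simp
  qed
  moreover have "(\<Sum>k<i. (1/2)^k) \<le> (2::real)" for i
    by (simp add: sum_gp_strict)
  ultimately have qn: "q c (int_box (n i)) \<le> 2" for i using order_trans by blast
  have "(\<lambda>j. (cmod (c j))\<^sup>2) summable_on UNIV"
  proof (rule nonneg_bdd_above_summable_on)
    show "bdd_above (sum (\<lambda>j. (cmod (c j))\<^sup>2) ` {F. F \<subseteq> UNIV \<and> finite F})"
    proof (rule bdd_aboveI2[where M = 2])
      fix F :: "(int ^ 'd) set" assume "F \<in> {F. F \<subseteq> UNIV \<and> finite F}"
      then obtain N where N: "F \<subseteq> int_box N" using finite_subset_int_box[of F 0] by auto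
      have "N \<le> n N" using n_mono by (rule strict_mono_imp_increasing)
      then have "F \<subseteq> int_box (n N)" using N int_box_mono by blast
      then have "(\<Sum>j\<in>F. (cmod (c j))\<^sup>2) \<le> q c (int_box (n N))"
        unfolding q_def by (intro sum_mono2 finite_int_box) auto
      then show "(\<Sum>j\<in>F. (cmod (c j))\<^sup>2) \<le> 2" using qn order_trans by blast
    qed
  qed auto
  then obtain g where g: "g \<in> L2_space M" "L2_tendsto M (\<lambda>N x. \<Sum>j\<in>int_box N. c j * f j x) g"
    using H unfolding hilbertian_L2_def by blast
  have [measurable]: "g \<in> borel_measurable M" using g by (simp add: L2_space_iff)
  have "(\<lambda>N. sqnorm M (\<lambda>x. S c (int_box N) x - g x)) \<longlonglongrightarrow> 0"
    using g(2) by (simp add: L2_tendsto_iff S_def)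
  \<comment> \<open>Any bound below \<open>1/4\<close> contradicts the norm 1 of a block, since \<open>2 e + 2 e < 1\<close>.\<close>
  then have "\<forall>\<^sub>F N in sequentially. sqnorm M (\<lambda>x. S c (int_box N) x - g x) < ennreal (1/8)"
    by (rule order_tendstoD) auto
  then obtain N where N: "\<And>m. m \<ge> N \<Longrightarrow> sqnorm M (\<lambda>x. S c (int_box m) x - g x) < ennreal (1/8)"
    by (auto simp: eventually_sequentially)
  have "N \<le> n N" using n_mono by (rule strict_mono_imp_increasing)
  then have ge: "n N \<ge> N" "n (Suc N) \<ge> N" using n_less[of N] by auto
  have "S c (G N) = (\<lambda>x. S c (int_box (n (Suc N))) x - S c (int_box (n N)) x)"
  proof
    fix x
    have "S c (int_box (n (Suc N))) x = S c (int_box (n N)) x + S c (G N) x"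
      unfolding S_def G_def by (rule sum_int_box_split[OF less_imp_le[OF n_less]])
    then show "S c (G N) x = S c (int_box (n (Suc N))) x - S c (int_box (n N)) x" by simp
  qed
  then have "1 = sqnorm M (\<lambda>x. S c (int_box (n (Suc N))) x - S c (int_box (n N)) x)" using SG[of N] by simp
  also have "\<dots> \<le> 2 * sqnorm M (\<lambda>x. S c (int_box (n (Suc N))) x - g x) + 2 * sqnorm M (\<lambda>x. S c (int_box (n N)) x - g x)"
    by (rule sqnorm_diff_le3) measurable
  also have "\<dots> \<le> 2 * ennreal (1/8) + 2 * ennreal (1/8)"
    using N[OF ge(1)] N[OF ge(2)] by (intro add_mono mult_left_mono) auto
  also have "\<dots> = ennreal (2 * (1/8) + 2 * (1/8))" by (simp only: ennreal_plus ennreal_mult') simp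
  also have "\<dots> = ennreal (1/2)" by simp
  also have "\<dots> < ennreal 1" by (subst ennreal_less_iff) auto
  finally show False by simp
qed

section \<open>Periodization and characters of the torus\<close>

text \<open>
  Sums over a countable type as integrals over the counting measure, where Tonelli's theorem
  is available.
\<close>

lemma infsum_ennreal_eq_nn_integral:
  fixes f :: "'a::countable \<Rightarrow> ennreal"
  shows "(\<Sum>\<^sub>\<infinity>m. f m) = (\<integral>\<^sup>+m. f m \<partial>count_space UNIV)"
proof (rule antisym)
  have "infsum f UNIV = (SUP F\<in>{F. finite F \<and> F \<subseteq> UNIV}. sum f F)"
    by (intro nonneg_infsum_complete) auto
  also have "\<dots> \<le> (\<integral>\<^sup>+m. f m \<partial>count_space UNIV)"
  proof (intro SUP_least)
    fix F :: "'a set" assume "F \<in> {F. finite F \<and> F \<subseteq> UNIV}"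
    then have "sum f F = (\<integral>\<^sup>+m. f m \<partial>count_space F)" by (simp add: nn_integral_count_space_finite)
    also have "\<dots> \<le> (\<integral>\<^sup>+m. f m \<partial>count_space UNIV)"
      by (simp add: nn_integral_count_space_indicator) (auto intro!: nn_integral_mono split: split_indicator)
    finally show "sum f F \<le> (\<integral>\<^sup>+m. f m \<partial>count_space UNIV)" .
  qed
  finally show "infsum f UNIV \<le> (\<integral>\<^sup>+m. f m \<partial>count_space UNIV)" .
next
  show "(\<integral>\<^sup>+m. f m \<partial>count_space UNIV) \<le> infsum f UNIV"
  proof (cases "finite (UNIV :: 'a set)")
    case True
    then show ?thesis by (simp add: nn_integral_count_space_finite)
  next
    case False
    then obtain e :: "nat \<Rightarrow> 'a" where e: "bij e"
      using bij_betw_from_nat_into[of "UNIV :: 'a set"] by auto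
    have "(\<integral>\<^sup>+m. f m \<partial>count_space UNIV) = (\<integral>\<^sup>+i. f (e i) \<partial>count_space UNIV)"
      using nn_integral_bij_count_space[OF e, of f] by simp
    also have "\<dots> = (\<Sum>i. f (e i))" by (rule nn_integral_count_space_nat)
    also have "\<dots> = (SUP n. \<Sum>i<n. f (e i))" by (rule suminf_eq_SUP)
    also have "\<dots> \<le> infsum f UNIV"
    proof (intro SUP_least)
      fix n
      have "(\<Sum>i<n. f (e i)) = sum f (e ` {..<n})"
        using e by (subst sum.reindex) (auto simp: bij_def inj_on_def)
      also have "\<dots> \<le> infsum f UNIV"
        by (subst nonneg_infsum_complete) (auto intro!: SUP_upper)
      finally show "(\<Sum>i<n. f (e i)) \<le> infsum f UNIV" .
    qed
    finally show ?thesis .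
  qed
qed

lemma real_vec_nth [simp]: "real_vec k $ i = real_of_int (k $ i)"
  by (simp add: real_vec_def)

lemma real_vec_0 [simp]: "real_vec 0 = 0"
  by (simp add: vec_eq_iff)

lemma real_vec_add: "real_vec (k + l) = real_vec k + real_vec l"
  by (simp add: vec_eq_iff)

lemma real_vec_minus: "real_vec (- k) = - real_vec k"
  by (simp add: vec_eq_iff)

definition unit_cube :: "(real ^ 'n) set" where
  "unit_cube = {\<xi>. \<forall>i. 0 \<le> \<xi> $ i \<and> \<xi> $ i < 1}"

definition floor_vec :: "real ^ 'n \<Rightarrow> int ^ 'n" where
  "floor_vec x = (\<chi> i. \<lfloor>x $ i\<rfloor>)"

lemma minus_real_vec_in_cube_iff: "x - real_vec m \<in> unit_cube \<longleftrightarrow> m = floor_vec x"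
proof -
  have "0 \<le> x $ i - real_of_int (m $ i) \<and> x $ i - real_of_int (m $ i) < 1 \<longleftrightarrow> m $ i = \<lfloor>x $ i\<rfloor>" for i
    by linarith
  then show ?thesis by (simp add: unit_cube_def floor_vec_def vec_eq_iff)
qed

lemma plus_real_vec_in_cube_iff: "x + real_vec m \<in> unit_cube \<longleftrightarrow> m = - floor_vec x"
  using minus_real_vec_in_cube_iff[of x "- m"] by (simp add: real_vec_minus) (metis minus_minus)

lemma unit_cube_measurable [measurable]: "unit_cube \<in> sets (borel :: (real ^ 'n) measure)"
proof -
  have "(\<lambda>x :: real ^ 'n. x $ i) \<in> borel_measurable borel" for i
    by (intro borel_measurable_continuous_onI continuous_intros)
  then have "Measurable.pred borel (\<lambda>x :: real ^ 'n. 0 \<le> x $ i \<and> x $ i < 1)" for i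
    by measurable
  then have "Measurable.pred borel (\<lambda>x :: real ^ 'n. \<forall>i\<in>UNIV. 0 \<le> x $ i \<and> x $ i < 1)"
    by (intro pred_intros_finite) auto
  then show ?thesis by (simp add: unit_cube_def pred_def)
qed

lemma torus_eq: "torus = restrict_space lborel unit_cube"
  by (simp add: torus_def unit_cube_def)

lemma space_torus: "space torus = unit_cube"
  by (simp add: torus_eq space_restrict_space)

lemma measurable_torus [measurable (raw)]: "f \<in> measurable borel N \<Longrightarrow> f \<in> measurable torus N"
  unfolding torus_eq by (intro measurable_restrict_space1) simp

lemma nn_integral_torus: "(\<integral>\<^sup>+x. f x \<partial>torus) = (\<integral>\<^sup>+x. f x * indicator unit_cube x \<partial>lborel)"
  unfolding torus_eq by (rule nn_integral_restrict_space) simp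

lemma nn_integral_affine:
  fixes f :: "'a::euclidean_space \<Rightarrow> ennreal"
  assumes [measurable]: "f \<in> borel_measurable borel" and c: "c \<noteq> 0"
  shows "(\<integral>\<^sup>+x. f x \<partial>lborel) = ennreal (\<bar>c\<bar> ^ DIM('a)) * (\<integral>\<^sup>+x. f (t + c *\<^sub>R x) \<partial>lborel)"
  by (subst lborel_affine[OF c, of t]) (simp add: nn_integral_density nn_integral_distr nn_integral_cmult)

lemma nn_integral_translate:
  fixes f :: "'a::euclidean_space \<Rightarrow> ennreal"
  assumes "f \<in> borel_measurable borel"
  shows "(\<integral>\<^sup>+x. f (x + t) \<partial>lborel) = (\<integral>\<^sup>+x. f x \<partial>lborel)"
  using nn_integral_affine[OF assms, of 1 t] by (simp add: add.commute)

lemma integral_affine: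
  fixes f :: "'a::euclidean_space \<Rightarrow> 'b::{banach, second_countable_topology}"
  assumes [measurable]: "f \<in> borel_measurable borel" and c: "c \<noteq> 0"
  shows "(\<integral>x. f x \<partial>lborel) = (\<bar>c\<bar> ^ DIM('a)) *\<^sub>R (\<integral>x. f (t + c *\<^sub>R x) \<partial>lborel)"
  by (subst lborel_affine[OF c, of t]) (simp add: integral_density integral_distr)

text \<open>Each point of space lies in exactly one integer translate of the half-open unit cube.\<close>

lemma nn_integral_periodization:
  fixes f :: "real ^ 'n \<Rightarrow> ennreal"
  assumes [measurable]: "f \<in> borel_measurable borel"
  shows "(\<integral>\<^sup>+x. f x \<partial>lborel) = (\<integral>\<^sup>+x. (\<Sum>\<^sub>\<infinity>m::int ^ 'n. f (x + real_vec m)) \<partial>torus)"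
proof -
  have "f x = (\<integral>\<^sup>+m. f x * indicator unit_cube (x - real_vec m) \<partial>count_space UNIV)" for x
  proof -
    have "(\<integral>\<^sup>+m. f x * indicator unit_cube (x - real_vec m) \<partial>count_space UNIV)
        = (\<integral>\<^sup>+m. f x * indicator {floor_vec x} m \<partial>count_space UNIV)"
      by (intro nn_integral_cong) (auto split: split_indicator simp: minus_real_vec_in_cube_iff)
    also have "\<dots> = f x"
      by (subst nn_integral_cmult_indicator) auto
    finally show ?thesis by simp
  qed
  then have "(\<integral>\<^sup>+x. f x \<partial>lborel)
      = (\<integral>\<^sup>+x. \<integral>\<^sup>+m. f x * indicator unit_cube (x - real_vec m) \<partial>count_space UNIV \<partial>lborel)"
    by simp
  also have "\<dots> = (\<integral>\<^sup>+m. \<integral>\<^sup>+x. f x * indicator unit_cube (x - real_vec m) \<partial>lborel \<partial>count_space UNIV)"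
    by (intro nn_integral_count_space_nn_integral) measurable
  also have "\<dots> = (\<integral>\<^sup>+m. \<integral>\<^sup>+x. f (x + real_vec m) * indicator unit_cube x \<partial>lborel \<partial>count_space UNIV)"
  proof (rule nn_integral_cong)
    fix m :: "int ^ 'n"
    show "(\<integral>\<^sup>+x. f x * indicator unit_cube (x - real_vec m) \<partial>lborel)
        = (\<integral>\<^sup>+x. f (x + real_vec m) * indicator unit_cube x \<partial>lborel)"
      using nn_integral_translate[of "\<lambda>x. f x * indicator unit_cube (x - real_vec m)" "real_vec m"] by simp
  qed
  also have "\<dots> = (\<integral>\<^sup>+x. \<integral>\<^sup>+m. f (x + real_vec m) * indicator unit_cube x \<partial>count_space UNIV \<partial>lborel)"
    by (intro nn_integral_count_space_nn_integral[symmetric]) measurable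
  also have "\<dots> = (\<integral>\<^sup>+x. (\<integral>\<^sup>+m. f (x + real_vec m) \<partial>count_space UNIV) * indicator unit_cube x \<partial>lborel)"
    by (intro nn_integral_cong nn_integral_multc) simp
  also have "\<dots> = (\<integral>\<^sup>+x. (\<Sum>\<^sub>\<infinity>m::int ^ 'n. f (x + real_vec m)) \<partial>torus)"
    by (simp add: nn_integral_torus infsum_ennreal_eq_nn_integral)
  finally show ?thesis .
qed

text \<open>
  A translate of the unit cube is again a fundamental domain of the integer lattice: the indicator
  of the translate sums to 1 over each orbit.
\<close>

lemma nn_integral_torus_translate:
  fixes f :: "real ^ 'n \<Rightarrow> ennreal"
  assumes [measurable]: "f \<in> borel_measurable borel"
    and per: "\<And>x m. f (x + real_vec m) = f x"
  shows "(\<integral>\<^sup>+x. f (x + a) \<partial>torus) = (\<integral>\<^sup>+x. f x \<partial>torus)"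
proof -
  have "(\<integral>\<^sup>+x. f (x + a) \<partial>torus) = (\<integral>\<^sup>+x. f x * indicator unit_cube (x - a) \<partial>lborel)"
    unfolding nn_integral_torus by (subst (2) nn_integral_translate[symmetric, where t = a]) auto
  also have "\<dots> = (\<integral>\<^sup>+x. (\<integral>\<^sup>+m. f x * indicator {- floor_vec (x - a)} m \<partial>count_space UNIV) \<partial>torus)"
    unfolding infsum_ennreal_eq_nn_integral[symmetric]
    by (subst nn_integral_periodization)
       (auto simp: per plus_real_vec_in_cube_iff[of "_ - a", symmetric] algebra_simps
             intro!: nn_integral_cong infsum_cong split: split_indicator)
  also have "\<dots> = (\<integral>\<^sup>+x. f x \<partial>torus)"
    by (subst nn_integral_cmult_indicator) auto
  finally show ?thesis .
qed

lemma emeasure_torus: "emeasure (torus :: (real ^ 'n) measure) (space torus) = 1"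
proof -
  have "emeasure (torus :: (real ^ 'n) measure) (space torus) = emeasure lborel (unit_cube :: (real ^ 'n) set)"
    unfolding space_torus unfolding torus_eq by (subst emeasure_restrict_space) auto
  moreover have "emeasure lborel (unit_cube :: (real ^ 'n) set) \<le> emeasure lborel (cbox 0 (1 :: real ^ 'n))"
    by (intro emeasure_mono) (auto simp: unit_cube_def mem_box_cart less_imp_le)
  moreover have "emeasure lborel (box 0 (1 :: real ^ 'n)) \<le> emeasure lborel (unit_cube :: (real ^ 'n) set)"
    by (intro emeasure_mono) (auto simp: unit_cube_def mem_box_cart less_imp_le)
  moreover have "emeasure lborel (box 0 (1 :: real ^ 'n)) = 1" "emeasure lborel (cbox 0 (1 :: real ^ 'n)) = 1"
    by (simp_all add: emeasure_lborel_box_eq emeasure_lborel_cbox_eq) 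
       (auto simp: Basis_vec_def inner_axis intro!: prod.neutral)
  ultimately show ?thesis by simp
qed

interpretation torus: prob_space "torus :: (real ^ 'n) measure"
  by standard (rule emeasure_torus)

lemma borel_measurable_cnj [measurable (raw)]:
  "f \<in> borel_measurable M \<Longrightarrow> (\<lambda>x. cnj (f x)) \<in> borel_measurable M"
  by (rule borel_measurable_continuous_on[of cnj]) (auto intro: continuous_intros)

definition character :: "int ^ 'n \<Rightarrow> real ^ 'n \<Rightarrow> complex" where
  "character k x = cis (2 * pi * (x \<bullet> real_vec k))"

lemma continuous_character: "continuous_on UNIV (character k)"
  unfolding character_def by (intro continuous_intros)

lemma character_measurable [measurable]: "character k \<in> borel_measurable borel"
  using continuous_character by (rule borel_measurable_continuous_onI)

lemma norm_character [simp]: "cmod (character k x) = 1"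
  by (simp add: character_def)

lemma character_0 [simp]: "character 0 x = 1"
  by (simp add: character_def)

lemma character_add: "character (k + l) x = character k x * character l x"
  by (simp add: character_def real_vec_add inner_add_right cis_mult algebra_simps)

lemma cnj_character: "cnj (character k x) = character (- k) x"
  by (simp add: character_def real_vec_minus cis_cnj)

lemma character_periodic: "character k (x + real_vec m) = character k x"
proof -
  have "real_vec m \<bullet> real_vec k = of_int (\<Sum>i\<in>UNIV. m $ i * k $ i)"
    by (simp add: inner_vec_def)
  then have "cis (2 * pi * (real_vec m \<bullet> real_vec k)) = 1"
    by (metis cis_multiple_2pi Ints_of_int)
  then show ?thesis
    by (simp add: character_def inner_add_left distrib_left flip: cis_mult)
qed

lemma integrable_torus_bounded:
  fixes f :: "real ^ 'n \<Rightarrow> complex"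
  assumes "f \<in> borel_measurable borel" "\<And>x. cmod (f x) \<le> B"
  shows "integrable torus f"
  using assms by (intro torus.integrable_const_bound[of f B]) auto

text \<open>
  Translating by half a period changes the sign of a nontrivial character but not its integral.  The
  translation invariance is stated for nonnegative functions, hence the detour through the
  nonnegative functions \<open>1 \<plusminus> h\<close>, where \<open>h\<close> is the real or the imaginary part.
\<close>

lemma integral_character:
  fixes k :: "int ^ 'n"
  shows "(\<integral>x. character k x \<partial>torus) = (if k = 0 then 1 else 0)"
proof (cases "k = 0")
  case True
  then show ?thesis by (simp add: torus.prob_space)
next
  case False
  then obtain i where i: "k $ i \<noteq> 0" by (auto simp: vec_eq_iff)
  \<comment> \<open>Half a period in a direction in which the character oscillates.\<close>
  define a :: "real ^ 'n" where "a = axis i (1 / (2 * real_of_int (k $ i)))"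
  have half: "a \<bullet> real_vec k = 1 / 2" using i by (simp add: a_def inner_axis')
  have "cis (2 * pi * (a \<bullet> real_vec k)) = -1" unfolding half by simp
  then have flip: "character k (x + a) = - character k x" for x
    by (simp add: character_def inner_add_left distrib_left flip: cis_mult)
  have zero: "(\<integral>x. h (character k x) \<partial>torus) = 0"
    if h: "continuous_on UNIV h" "\<And>z. h (- z) = - h z" "\<And>z. \<bar>h z\<bar> \<le> cmod z" for h :: "complex \<Rightarrow> real"
  proof -
    have [measurable]: "h \<in> borel_measurable borel" using h(1) by (rule borel_measurable_continuous_onI)
    have bound: "\<bar>h (character k x)\<bar> \<le> 1" for x using h(3)[of "character k x"] by simp
    have int: "integrable torus (\<lambda>x. h (character k x))"
      using bound by (intro torus.integrable_const_bound[of _ 1]) auto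
    have nonneg: "0 \<le> 1 + h (character k x)" "0 \<le> 1 - h (character k x)" for x
      using bound[of x] by linarith+
    have "ennreal (\<integral>x. 1 - h (character k x) \<partial>torus) = (\<integral>\<^sup>+x. ennreal (1 - h (character k x)) \<partial>torus)"
      using int nonneg by (intro nn_integral_eq_integral[symmetric]) auto
    also have "\<dots> = (\<integral>\<^sup>+x. ennreal (1 + h (character k (x + a))) \<partial>torus)"
      by (simp add: flip h(2))
    also have "\<dots> = (\<integral>\<^sup>+x. ennreal (1 + h (character k x)) \<partial>torus)"
      by (rule nn_integral_torus_translate) (auto simp: character_periodic)
    also have "\<dots> = ennreal (\<integral>x. 1 + h (character k x) \<partial>torus)"
      using int nonneg by (intro nn_integral_eq_integral) auto
    finally have "(\<integral>x. 1 - h (character k x) \<partial>torus) = (\<integral>x. 1 + h (character k x) \<partial>torus)"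
      using nonneg by (subst (asm) ennreal_inj) (auto intro!: integral_nonneg)
    then show ?thesis using int by (simp add: torus.prob_space)
  qed
  have int: "integrable torus (character k)" by (rule integrable_torus_bounded[of _ 1]) auto
  have "Re (\<integral>x. character k x \<partial>torus) = 0" "Im (\<integral>x. character k x \<partial>torus) = 0"
    using zero[of Re] zero[of Im] int
    by (simp_all add: continuous_intros abs_Re_le_cmod abs_Im_le_cmod)
  then show ?thesis using False by (simp add: complex_eq_iff)
qed

lemma integral_character_cnj:
  "(\<integral>x. character k x * cnj (character l x) \<partial>torus) = (if k = l then 1 else 0)"
  using integral_character[of "k - l"]
  by (simp add: cnj_character flip: character_add)

definition trig :: "(int ^ 'n) set \<Rightarrow> (int ^ 'n \<Rightarrow> complex) \<Rightarrow> real ^ 'n \<Rightarrow> complex" where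
  "trig F c x = (\<Sum>k\<in>F. c k * character k x)"

lemma trig_measurable [measurable]: "trig F c \<in> borel_measurable borel"
  unfolding trig_def by measurable

lemma norm_trig_le: "cmod (trig F c x) \<le> (\<Sum>k\<in>F. cmod (c k))"
  unfolding trig_def by (intro order_trans[OF norm_sum]) (simp add: norm_mult)

text \<open>
  By orthonormality.  This turns the square sum of the coefficients in a Hilbertian bound into an
  integral over the torus.
\<close>

lemma sqnorm_torus_trig:
  assumes F: "finite F"
  shows "sqnorm torus (trig F c) = ennreal (\<Sum>k\<in>F. (cmod (c k))\<^sup>2)"
proof -
  have "(\<integral>x. trig F c x * cnj (trig F c x) \<partial>torus)
     = (\<integral>x. (\<Sum>k\<in>F. \<Sum>l\<in>F. (c k * cnj (c l)) * (character k x * cnj (character l x))) \<partial>torus)"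
    by (simp add: trig_def sum_product mult_ac)
  also have "\<dots> = (\<Sum>k\<in>F. \<Sum>l\<in>F. (c k * cnj (c l)) * (\<integral>x. character k x * cnj (character l x) \<partial>torus))"
    by (simp add: Bochner_Integration.integral_sum integrable_torus_bounded[of _ 1] norm_mult)
  also have "\<dots> = (\<Sum>k\<in>F. c k * cnj (c k))"
    using F by (simp add: integral_character_cnj if_distrib cong: if_cong)
  also have "\<dots> = of_real (\<Sum>k\<in>F. (cmod (c k))\<^sup>2)"
    by (simp add: complex_norm_square[symmetric])
  finally have "(\<integral>x. complex_of_real ((cmod (trig F c x))\<^sup>2) \<partial>torus) = of_real (\<Sum>k\<in>F. (cmod (c k))\<^sup>2)"
    by (simp add: complex_norm_square[symmetric])
  then have "(\<integral>x. (cmod (trig F c x))\<^sup>2 \<partial>torus) = (\<Sum>k\<in>F. (cmod (c k))\<^sup>2)"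
    by (metis integral_complex_of_real of_real_eq_iff)
  moreover have "integrable torus (\<lambda>x. (cmod (trig F c x))\<^sup>2)"
    using norm_trig_le[of F c]
    by (intro torus.integrable_const_bound[of _ "(\<Sum>k\<in>F. cmod (c k))\<^sup>2"]) (auto intro!: power_mono)
  ultimately show ?thesis
    unfolding sqnorm_def by (subst nn_integral_eq_integral) auto
qed

section \<open>The Fourier transform contracts the square norm\<close>

definition fourier :: "(real ^ 'n \<Rightarrow> complex) \<Rightarrow> real ^ 'n \<Rightarrow> complex" where
  "fourier g \<zeta> = (\<integral>x. g x * cis (2 * pi * (x \<bullet> \<zeta>)) \<partial>lborel)"

lemma cis_inner_measurable [measurable]:
  "(\<lambda>(x, \<zeta>). cis (2 * pi * (x \<bullet> \<zeta>))) \<in> borel_measurable (borel \<Otimes>\<^sub>M (borel :: (real ^ 'n) measure))"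
  unfolding borel_prod case_prod_beta by (intro borel_measurable_continuous_onI continuous_intros)

lemma fourier_measurable [measurable]:
  assumes [measurable]: "g \<in> borel_measurable borel"
  shows "fourier g \<in> borel_measurable borel"
  unfolding fourier_def by measurable

lemma integrable_torus_of_L2:
  assumes [measurable]: "g \<in> borel_measurable borel" and "sqnorm torus g < \<infinity>"
  shows "integrable torus (\<lambda>x. (cmod (g x))\<^sup>2)" "integrable torus g"
proof -
  show sq: "integrable torus (\<lambda>x. (cmod (g x))\<^sup>2)"
    using assms by (intro integrableI_bounded) (auto simp: sqnorm_def)
  show "integrable torus g"
  proof (rule Bochner_Integration.integrable_bound)
    show "integrable torus (\<lambda>x. 1 + (cmod (g x))\<^sup>2)" using sq by simp
    have "cmod (g x) \<le> 1 + (cmod (g x))\<^sup>2" for x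
      using sum_squares_bound[of "cmod (g x)" 1] zero_le_power2[of "cmod (g x)"] norm_ge_zero[of "g x"]
      by (simp; linarith)
    then show "AE x in torus. cmod (g x) \<le> norm (1 + (cmod (g x))\<^sup>2)" by auto
  qed measurable
qed

text \<open>
  The functions \<open>exp (2 \<pi> i x \<bullet> (\<theta> + k))\<close> with fixed \<open>\<theta>\<close> differ from the characters by a common unimodular factor,
  so they are orthonormal on the torus as well.  Bessel's inequality results from expanding the squared
  distance of \<open>g\<close> from its projection onto the span of their conjugates, which is the conjugate of \<open>s\<close>
  in the proof.
\<close>

lemma bessel_shifted:
  fixes g :: "real ^ 'n \<Rightarrow> complex"
  assumes [measurable]: "g \<in> borel_measurable borel"
    and fin: "sqnorm torus g < \<infinity>" and F: "finite F"
  shows "ennreal (\<Sum>k\<in>F. (cmod (\<integral>x. g x * cis (2 * pi * (x \<bullet> (\<theta> + real_vec k))) \<partial>torus))\<^sup>2) \<le> sqnorm torus g"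
proof -
  define a where "a k = (\<integral>x. g x * cis (2 * pi * (x \<bullet> (\<theta> + real_vec k))) \<partial>torus)" for k :: "int ^ 'n"
  define s where "s x = (\<Sum>k\<in>F. cnj (a k) * cis (2 * pi * (x \<bullet> (\<theta> + real_vec k))))" for x
  have cis_m: "(\<lambda>x. cis (2 * pi * (x \<bullet> v))) \<in> borel_measurable borel" for v :: "real ^ 'n"
    by (intro borel_measurable_continuous_onI continuous_intros)
  note [measurable] = cis_m
  have [measurable]: "s \<in> borel_measurable borel" unfolding s_def by measurable
  have s_trig: "s x = cis (2 * pi * (x \<bullet> \<theta>)) * trig F (\<lambda>k. cnj (a k)) x" for x
    by (simp add: s_def trig_def character_def sum_distrib_left inner_add_right distrib_left mult_ac flip: cis_mult)
  have norm_s: "cmod (s x) = cmod (trig F (\<lambda>k. cnj (a k)) x)" for x by (simp add: s_trig norm_mult)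
  have bound_s: "cmod (s x) \<le> (\<Sum>k\<in>F. cmod (a k))" for x
    unfolding norm_s using norm_trig_le[of F "\<lambda>k. cnj (a k)" x] by simp
  define A where "A = (\<Sum>k\<in>F. (cmod (a k))\<^sup>2)"
  have A: "A \<ge> 0" by (simp add: A_def sum_nonneg)
  note g2 = integrable_torus_of_L2[OF assms(1) fin]
  have s2: "integrable torus (\<lambda>x. (cmod (s x))\<^sup>2)"
    using bound_s by (intro torus.integrable_const_bound[of _ "(\<Sum>k\<in>F. cmod (a k))\<^sup>2"]) (auto intro!: power_mono)
  have int_s2: "(\<integral>x. (cmod (s x))\<^sup>2 \<partial>torus) = A"
  proof -
    have "ennreal (\<integral>x. (cmod (s x))\<^sup>2 \<partial>torus) = sqnorm torus (trig F (\<lambda>k. cnj (a k)))"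
      unfolding sqnorm_def norm_s[symmetric] using s2 by (intro nn_integral_eq_integral[symmetric]) auto
    also have "\<dots> = ennreal A" by (simp add: sqnorm_torus_trig[OF F] A_def)
    finally show ?thesis using A by (subst (asm) ennreal_inj) (auto intro!: integral_nonneg)
  qed
  have g_cis: "integrable torus (\<lambda>x. g x * cis (2 * pi * (x \<bullet> v)))" for v
    by (rule Bochner_Integration.integrable_bound[OF g2(2)]) (auto simp: norm_mult)
  have gs: "integrable torus (\<lambda>x. g x * s x)"
    unfolding s_def sum_distrib_left mult.left_commute[of "g _"]
    by (intro Bochner_Integration.integrable_sum integrable_mult_right g_cis)
  have "(\<integral>x. g x * s x \<partial>torus) = (\<Sum>k\<in>F. cnj (a k) * a k)"
    unfolding s_def sum_distrib_left mult.left_commute[of "g _"] a_def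
    by (subst Bochner_Integration.integral_sum) (auto intro: g_cis)
  also have "\<dots> = of_real A"
    unfolding A_def of_real_sum complex_norm_square by (simp add: mult.commute)
  finally have gs_eq: "(\<integral>x. g x * s x \<partial>torus) = of_real A" .
  define r where "r x = Re (g x * s x)" for x
  have r: "integrable torus r" "(\<integral>x. r x \<partial>torus) = A"
    unfolding r_def[abs_def] using integrable_Re[OF gs] integral_Re[OF gs] gs_eq by (simp_all del: times_complex.sel)
  have "0 \<le> (\<integral>x. (cmod (g x - cnj (s x)))\<^sup>2 \<partial>torus)" by (rule integral_nonneg_AE) simp
  also have "\<dots> = (\<integral>x. (cmod (g x))\<^sup>2 - 2 * r x + (cmod (s x))\<^sup>2 \<partial>torus)"
    by (intro Bochner_Integration.integral_cong refl) (simp add: r_def cmod_power2, simp add: power2_eq_square algebra_simps)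
  also have "\<dots> = (\<integral>x. (cmod (g x))\<^sup>2 \<partial>torus) - 2 * A + A"
    using g2(1) s2 r int_s2 by simp
  finally have "A \<le> (\<integral>x. (cmod (g x))\<^sup>2 \<partial>torus)" by simp
  then have "ennreal A \<le> ennreal (\<integral>x. (cmod (g x))\<^sup>2 \<partial>torus)" by (rule ennreal_leI)
  also have "\<dots> = sqnorm torus g"
    unfolding sqnorm_def using g2(1) by (intro nn_integral_eq_integral[symmetric]) auto
  finally show ?thesis
    by (simp add: A_def a_def)
qed

text \<open>
  The values of the Fourier transform on a coset \<open>\<theta> + \<int>\<^sup>n\<close> are the coefficients of \<open>g\<close> with respect to
  the shifted characters.  Integrating Bessel's inequality over \<open>\<theta>\<close> covers the whole space.
\<close>

lemma sqnorm_fourier_le_cube: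
  fixes g :: "real ^ 'n \<Rightarrow> complex"
  assumes [measurable]: "g \<in> borel_measurable borel"
    and supp: "\<And>x. x \<notin> unit_cube \<Longrightarrow> g x = 0"
  shows "sqnorm lborel (fourier g) \<le> sqnorm lborel g"
proof (cases "sqnorm lborel g < \<infinity>")
  case True
  have eq: "sqnorm torus g = sqnorm lborel g"
    unfolding sqnorm_def nn_integral_torus using supp
    by (intro nn_integral_cong) (auto split: split_indicator)
  have fourier_eq: "fourier g \<zeta> = (\<integral>x. g x * cis (2 * pi * (x \<bullet> \<zeta>)) \<partial>torus)" for \<zeta>
    unfolding fourier_def torus_eq using supp
    by (subst integral_restrict_space) (auto intro!: Bochner_Integration.integral_cong split: split_indicator)
  have "sqnorm lborel (fourier g) = (\<integral>\<^sup>+\<theta>. (\<Sum>\<^sub>\<infinity>k::int ^ 'n. ennreal ((cmod (fourier g (\<theta> + real_vec k)))\<^sup>2)) \<partial>torus)"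
    unfolding sqnorm_def by (rule nn_integral_periodization) measurable
  also have "\<dots> \<le> (\<integral>\<^sup>+\<theta>. sqnorm torus g \<partial>(torus :: (real ^ 'n) measure))"
  proof (rule nn_integral_mono)
    fix \<theta> :: "real ^ 'n"
    show "(\<Sum>\<^sub>\<infinity>k::int ^ 'n. ennreal ((cmod (fourier g (\<theta> + real_vec k)))\<^sup>2)) \<le> sqnorm torus g"
      using True unfolding eq[symmetric] fourier_eq
      by (subst nonneg_infsum_complete) (auto intro!: SUP_least bessel_shifted)
  qed
  also have "\<dots> = sqnorm torus g" by (simp add: emeasure_torus)
  finally show ?thesis using eq by simp
qed (simp add: not_less top.extremum_unique)

text \<open>
  A ball of radius \<open>R\<close> is moved into the unit cube by the translation \<open>t\<close> and the dilation by \<open>1/L\<close>;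
  both sides of the estimate scale by the same factor.
\<close>

lemma sqnorm_fourier_le:
  fixes g :: "real ^ 'n \<Rightarrow> complex"
  assumes [measurable]: "g \<in> borel_measurable borel"
    and supp: "\<And>x. norm x \<ge> R \<Longrightarrow> g x = 0" and R: "R > 0"
  shows "sqnorm lborel (fourier g) \<le> sqnorm lborel g"
proof -
  define L where "L = 2 * R"
  define t :: "real ^ 'n" where "t = (\<chi> i. R)"
  define h where "h u = g (L *\<^sub>R u - t)" for u
  have L: "L > 0" using R by (simp add: L_def)
  have [measurable]: "h \<in> borel_measurable borel" unfolding h_def by measurable
  have h0: "h u = 0" if "u \<notin> unit_cube" for u
  proof (rule ccontr)
    assume "h u \<noteq> 0"
    then have "norm (L *\<^sub>R u - t) < R" using supp by (force simp: h_def not_le[symmetric])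
    then have "\<bar>L * u $ i - R\<bar> < R" for i
      using component_le_norm_cart[of "L *\<^sub>R u - t" i] by (simp add: t_def)
    then have "0 < L * u $ i \<and> L * u $ i < L" for i
      unfolding abs_less_iff L_def by (metis add.commute diff_less_eq less_diff_eq minus_less_iff mult_2 right_minus_eq diff_add_cancel add_less_cancel_left add_cancel_left_right minus_diff_eq neg_less_iff_less)
    then have "0 < u $ i \<and> u $ i < 1" for i
      using L by (metis mult.commute mult_less_cancel_left_pos mult.right_neutral zero_less_mult_pos)
    then show False using that by (auto simp: unit_cube_def less_imp_le)
  qed
  define n where "n = DIM(real ^ 'n)"
  have h_g: "h ((1/L) *\<^sub>R t + (1/L) *\<^sub>R x) = g x" for x
    using L by (simp add: h_def algebra_simps)
  have norm_h: "sqnorm lborel h = ennreal ((1/L) ^ n) * sqnorm lborel g"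
    unfolding sqnorm_def using L
    by (subst nn_integral_affine[of _ "1/L" "(1/L) *\<^sub>R t"]) (auto simp: h_g n_def)
  have fourier_h: "fourier h \<zeta> = (1/L)^n *\<^sub>R (cis (2 * pi * (((1/L) *\<^sub>R t) \<bullet> \<zeta>)) * fourier g ((1/L) *\<^sub>R \<zeta>))" for \<zeta>
  proof -
    have "fourier h \<zeta> = (1/L)^n *\<^sub>R (\<integral>x. g x * cis (2 * pi * (((1/L) *\<^sub>R t + (1/L) *\<^sub>R x) \<bullet> \<zeta>)) \<partial>lborel)"
      unfolding fourier_def using L
      by (subst integral_affine[of _ "1/L" "(1/L) *\<^sub>R t"]) (auto simp: h_g n_def intro!: borel_measurable_continuous_onI continuous_intros borel_measurable_times)
    also have "(\<integral>x. g x * cis (2 * pi * (((1/L) *\<^sub>R t + (1/L) *\<^sub>R x) \<bullet> \<zeta>)) \<partial>lborel)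
       = (\<integral>x. cis (2 * pi * (((1/L) *\<^sub>R t) \<bullet> \<zeta>)) * (g x * cis (2 * pi * (x \<bullet> ((1/L) *\<^sub>R \<zeta>)))) \<partial>lborel)"
      by (intro Bochner_Integration.integral_cong refl) (simp add: inner_add_left distrib_left mult_ac flip: cis_mult)
    also have "\<dots> = cis (2 * pi * (((1/L) *\<^sub>R t) \<bullet> \<zeta>)) * fourier g ((1/L) *\<^sub>R \<zeta>)"
      unfolding fourier_def by simp
    finally show ?thesis .
  qed
  have "sqnorm lborel (fourier h)
      = (\<integral>\<^sup>+\<zeta>. ennreal (((1/L)^n)\<^sup>2) * ennreal ((cmod (fourier g ((1/L) *\<^sub>R \<zeta>)))\<^sup>2) \<partial>lborel)"
    unfolding sqnorm_def fourier_h using L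
    by (simp add: norm_mult power_mult_distrib ennreal_mult)
  also have "\<dots> = ennreal (((1/L)^n)\<^sup>2) * (\<integral>\<^sup>+\<zeta>. ennreal ((cmod (fourier g ((1/L) *\<^sub>R \<zeta>)))\<^sup>2) \<partial>lborel)"
    by (rule nn_integral_cmult) measurable
  also have "\<dots> = ennreal (((1/L)^n)\<^sup>2) * (ennreal (L^n) * sqnorm lborel (fourier g))"
    unfolding sqnorm_def using L
    by (subst nn_integral_affine[of _ L 0]) (auto simp: n_def)
  also have "\<dots> = ennreal ((1/L)^n) * sqnorm lborel (fourier g)"
    using L by (simp add: power2_eq_square power_divide flip: ennreal_mult mult.assoc)
  finally have fourier_h_norm: "sqnorm lborel (fourier h) = ennreal ((1/L)^n) * sqnorm lborel (fourier g)" .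
  have "ennreal ((1/L)^n) * sqnorm lborel (fourier g) \<le> ennreal ((1/L)^n) * sqnorm lborel g"
    unfolding fourier_h_norm[symmetric] norm_h[symmetric] by (rule sqnorm_fourier_le_cube) (auto simp: h0)
  then have "ennreal (L^n) * (ennreal ((1/L)^n) * sqnorm lborel (fourier g)) \<le> ennreal (L^n) * (ennreal ((1/L)^n) * sqnorm lborel g)"
    by (rule mult_left_mono) simp
  moreover have "ennreal (L^n) * ennreal ((1/L)^n) = 1"
    using L by (simp add: power_divide flip: ennreal_mult)
  ultimately show ?thesis
    by (simp only: mult.assoc[symmetric] mult_1_left)
qed

section \<open>The kernel of the Weyl transform\<close>

lemma cis_inner_left_measurable [measurable]:
  "(\<lambda>x. cis (2 * pi * (x \<bullet> v))) \<in> borel_measurable (borel :: (real ^ 'n) measure)"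
  by (intro borel_measurable_continuous_onI continuous_intros)

lemma borel_pair_measurable:
  fixes f :: "(real ^ 'n) \<times> (real ^ 'n) \<Rightarrow> 'b::topological_space"
  assumes "f \<in> borel_measurable borel"
  shows "f \<in> borel_measurable (borel \<Otimes>\<^sub>M borel)"
  using assms by (simp only: borel_prod)

lemma nn_integral_slices:
  fixes G :: "(real ^ 'n) \<times> (real ^ 'n) \<Rightarrow> ennreal"
  assumes [measurable]: "G \<in> borel_measurable borel"
  shows "(\<integral>\<^sup>+p. G p \<partial>lborel) = (\<integral>\<^sup>+y. \<integral>\<^sup>+x. G (x, y) \<partial>lborel \<partial>lborel)"
    and "(\<integral>\<^sup>+p. G p \<partial>lborel) = (\<integral>\<^sup>+x. \<integral>\<^sup>+y. G (x, y) \<partial>lborel \<partial>lborel)"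
proof -
  have G: "G \<in> borel_measurable (lborel \<Otimes>\<^sub>M lborel)"
    unfolding lborel_prod by simp
  show "(\<integral>\<^sup>+p. G p \<partial>lborel) = (\<integral>\<^sup>+y. \<integral>\<^sup>+x. G (x, y) \<partial>lborel \<partial>lborel)"
    using lborel_pair.nn_integral_snd[OF G] by (simp add: lborel_prod)
  show "(\<integral>\<^sup>+p. G p \<partial>lborel) = (\<integral>\<^sup>+x. \<integral>\<^sup>+y. G (x, y) \<partial>lborel \<partial>lborel)"
    using lborel.nn_integral_fst[of G lborel] G by (simp add: lborel_prod)
qed

text \<open>
  The coordinates \<open>y = \<eta> - \<xi>\<close> and \<open>\<zeta> = (\<xi> + \<eta>)/2\<close> preserve the measure.  In these coordinates the kernel of
  the Weyl transform is the Fourier transform in the first variable.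
\<close>

lemma nn_integral_shear:
  fixes G :: "(real ^ 'n) \<times> (real ^ 'n) \<Rightarrow> ennreal"
  assumes [measurable]: "G \<in> borel_measurable borel"
  shows "(\<integral>\<^sup>+p. G p \<partial>lborel) = (\<integral>\<^sup>+y. \<integral>\<^sup>+\<zeta>. G (\<zeta> - (1/2) *\<^sub>R y, \<zeta> + (1/2) *\<^sub>R y) \<partial>lborel \<partial>lborel)"
proof -
  note [measurable] = borel_pair_measurable[OF assms]
  have "(\<integral>\<^sup>+p. G p \<partial>lborel) = (\<integral>\<^sup>+x. \<integral>\<^sup>+y. G (x, y) \<partial>lborel \<partial>lborel)"
    by (rule nn_integral_slices) simp
  also have "\<dots> = (\<integral>\<^sup>+x. \<integral>\<^sup>+y. G (x, y + x) \<partial>lborel \<partial>lborel)"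
    by (intro nn_integral_cong nn_integral_translate[symmetric]) measurable
  also have "\<dots> = (\<integral>\<^sup>+y. \<integral>\<^sup>+x. G (x, y + x) \<partial>lborel \<partial>lborel)"
    by (rule lborel_pair.Fubini'[symmetric]) measurable
  also have "\<dots> = (\<integral>\<^sup>+y. \<integral>\<^sup>+x. G (x + - ((1/2) *\<^sub>R y), y + (x + - ((1/2) *\<^sub>R y))) \<partial>lborel \<partial>lborel)"
    by (intro nn_integral_cong nn_integral_translate[symmetric, of "\<lambda>x. G (x, _ + x)"]) measurable
  also have "\<dots> = (\<integral>\<^sup>+y. \<integral>\<^sup>+\<zeta>. G (\<zeta> - (1/2) *\<^sub>R y, \<zeta> + (1/2) *\<^sub>R y) \<partial>lborel \<partial>lborel)"
  proof (intro nn_integral_cong)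
    fix x y :: "real ^ 'n"
    have "y + (x + - ((1/2) *\<^sub>R y)) = x + (1/2) *\<^sub>R y" by (simp add: vec_eq_iff)
    then show "G (x + - ((1/2) *\<^sub>R y), y + (x + - ((1/2) *\<^sub>R y))) = G (x - (1/2) *\<^sub>R y, x + (1/2) *\<^sub>R y)"
      by (simp only: diff_conv_add_uminus)
  qed
  finally show ?thesis .
qed

definition cutoff :: "real \<Rightarrow> ((real ^ 'n) \<times> (real ^ 'n) \<Rightarrow> complex) \<Rightarrow> (real ^ 'n) \<times> (real ^ 'n) \<Rightarrow> complex" where
  "cutoff R f = (\<lambda>(x, y). if norm x < R then f (x, y) else 0)"

lemma cutoff_measurable [measurable]:
  assumes "f \<in> borel_measurable borel"
  shows "cutoff R f \<in> borel_measurable borel"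
proof -
  note [measurable] = borel_pair_measurable[OF assms]
  show ?thesis unfolding cutoff_def borel_prod[symmetric] by measurable
qed

lemma slice_measurable:
  fixes f :: "(real ^ 'n) \<times> (real ^ 'n) \<Rightarrow> 'b::topological_space"
  assumes "f \<in> borel_measurable borel"
  shows "(\<lambda>x. f (x, y)) \<in> borel_measurable borel"
proof -
  note [measurable] = borel_pair_measurable[OF assms]
  show ?thesis by measurable
qed

lemma truncated_weyl_kernel_eq:
  "truncated_weyl_kernel N f (\<xi>, \<eta>) = fourier (\<lambda>x. cutoff (real N) f (x, \<eta> - \<xi>)) ((1/2) *\<^sub>R (\<xi> + \<eta>))"
  unfolding truncated_weyl_kernel_def fourier_def set_lebesgue_integral_def prod.case
proof (intro Bochner_Integration.integral_cong refl)
  fix x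
  have "exp (\<i> * of_real pi * of_real (x \<bullet> (\<xi> + \<eta>))) = cis (2 * pi * (x \<bullet> ((1/2) *\<^sub>R (\<xi> + \<eta>))))"
    by (simp add: cis_conv_exp mult_ac)
  then show "indicat_real (ball 0 (real N)) x *\<^sub>R (f (x, \<eta> - \<xi>) * exp (\<i> * of_real pi * of_real (x \<bullet> (\<xi> + \<eta>))))
     = cutoff (real N) f (x, \<eta> - \<xi>) * cis (2 * pi * (x \<bullet> ((1/2) *\<^sub>R (\<xi> + \<eta>))))"
    by (simp add: cutoff_def)
qed

lemma truncated_weyl_kernel_slice:
  "truncated_weyl_kernel N f (\<zeta> - (1/2) *\<^sub>R y, \<zeta> + (1/2) *\<^sub>R y) = fourier (\<lambda>x. cutoff (real N) f (x, y)) \<zeta>"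
proof -
  have "\<zeta> + (1/2) *\<^sub>R y - (\<zeta> - (1/2) *\<^sub>R y) = y"
    "(1/2) *\<^sub>R (\<zeta> - (1/2) *\<^sub>R y + (\<zeta> + (1/2) *\<^sub>R y)) = \<zeta>"
    by (simp_all add: vec_eq_iff)
  then show ?thesis by (simp only: truncated_weyl_kernel_eq)
qed

lemma fourier_slice_measurable [measurable]:
  fixes f :: "(real ^ 'n) \<times> (real ^ 'n) \<Rightarrow> complex"
  assumes "f \<in> borel_measurable borel"
  shows "(\<lambda>(y, \<zeta>). fourier (\<lambda>x. f (x, y)) \<zeta>) \<in> borel_measurable (borel \<Otimes>\<^sub>M borel)"
proof -
  note [measurable] = borel_pair_measurable[OF assms]
  show ?thesis unfolding fourier_def by measurable
qed

lemma truncated_weyl_kernel_measurable [measurable]: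
  fixes f :: "(real ^ 'n) \<times> (real ^ 'n) \<Rightarrow> complex"
  assumes f: "f \<in> borel_measurable borel"
  shows "truncated_weyl_kernel N f \<in> borel_measurable borel"
proof -
  note m = fourier_slice_measurable[OF cutoff_measurable[OF f, of "real N"]]
  have "truncated_weyl_kernel N f
      = (\<lambda>(y, \<zeta>). fourier (\<lambda>x. cutoff (real N) f (x, y)) \<zeta>) \<circ> (\<lambda>(\<xi>, \<eta>). (\<eta> - \<xi>, (1/2) *\<^sub>R (\<xi> + \<eta>)))"
    by (auto simp: fun_eq_iff truncated_weyl_kernel_eq)
  moreover have "(\<lambda>(\<xi>, \<eta>). (\<eta> - \<xi>, (1/2) *\<^sub>R (\<xi> + \<eta>))) \<in> measurable (borel \<Otimes>\<^sub>M borel) (borel \<Otimes>\<^sub>M (borel :: (real ^ 'n) measure))"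
    by measurable
  ultimately show ?thesis
    using measurable_comp[OF _ m] by (simp add: borel_prod)
qed

lemma sqnorm_slices:
  fixes f :: "(real ^ 'n) \<times> (real ^ 'n) \<Rightarrow> complex"
  assumes [measurable]: "f \<in> borel_measurable borel"
  shows "sqnorm lborel f = (\<integral>\<^sup>+y. sqnorm lborel (\<lambda>x. f (x, y)) \<partial>lborel)"
  unfolding sqnorm_def by (rule nn_integral_slices) measurable

lemma integrable_of_L2_bounded_support:
  fixes g :: "real ^ 'n \<Rightarrow> complex"
  assumes [measurable]: "g \<in> borel_measurable borel"
    and fin: "sqnorm lborel g < \<infinity>" and supp: "\<And>x. norm x \<ge> R \<Longrightarrow> g x = 0"
  shows "integrable lborel g"
proof (rule Bochner_Integration.integrable_bound)
  have "integrable lborel (\<lambda>x. (cmod (g x))\<^sup>2)"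
    using fin by (intro integrableI_bounded) (auto simp: sqnorm_def)
  moreover have "integrable lborel (indicat_real (ball (0 :: real ^ 'n) R))"
    using emeasure_bounded_finite[of "ball (0 :: real ^ 'n) R"] by simp
  ultimately show "integrable lborel (\<lambda>x. indicat_real (ball 0 R) x + (cmod (g x))\<^sup>2)" by simp
  have "cmod (g x) \<le> 1 + (cmod (g x))\<^sup>2" for x
    using sum_squares_bound[of "cmod (g x)" 1] zero_le_power2[of "cmod (g x)"] norm_ge_zero[of "g x"]
    by (simp; linarith)
  then have "cmod (g x) \<le> indicat_real (ball 0 R) x + (cmod (g x))\<^sup>2" for x
    using supp[of x] by (cases "norm x < R") auto
  then show "AE x in lborel. cmod (g x) \<le> norm (indicat_real (ball 0 R) x + (cmod (g x))\<^sup>2)" by auto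
qed simp

lemma fourier_diff:
  assumes "integrable lborel g" "integrable lborel h"
  shows "fourier g \<zeta> - fourier h \<zeta> = fourier (\<lambda>x. g x - h x) \<zeta>"
proof -
  have "integrable lborel (\<lambda>x. k x * cis (2 * pi * (x \<bullet> \<zeta>)))" if "integrable lborel k" for k
  proof (rule Bochner_Integration.integrable_bound[OF that])
    have [measurable]: "k \<in> borel_measurable borel" using that by auto
    have "(\<lambda>x. cis (2 * pi * (x \<bullet> \<zeta>))) \<in> borel_measurable borel"
      by (intro borel_measurable_continuous_onI continuous_intros)
    then show "(\<lambda>x. k x * cis (2 * pi * (x \<bullet> \<zeta>))) \<in> borel_measurable lborel" by simp
  qed (simp add: norm_mult)
  then show ?thesis
    using assms unfolding fourier_def by (simp add: left_diff_distrib Bochner_Integration.integral_diff)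
qed

text \<open>
  On such slices the truncated function is integrable, so that its Fourier integral is additive;
  on the other slices it may be the default value 0 of a divergent Bochner integral.
\<close>

lemma AE_slice_L2:
  fixes f :: "(real ^ 'n) \<times> (real ^ 'n) \<Rightarrow> complex"
  assumes "f \<in> L2_space lborel"
  shows "AE y in lborel. sqnorm lborel (\<lambda>x. f (x, y)) < \<infinity>"
proof -
  have f: "f \<in> borel_measurable borel" "sqnorm lborel f < \<infinity>" using assms by (auto simp: L2_space_iff)
  note [measurable] = borel_pair_measurable[OF f(1)]
  have "AE y in lborel. sqnorm lborel (\<lambda>x. f (x, y)) \<noteq> \<infinity>"
    using f by (intro nn_integral_PInf_AE) (auto simp: sqnorm_slices[symmetric], simp add: sqnorm_def)
  then show ?thesis by (simp add: less_top)
qed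

lemma sqnorm_mono: "(\<And>x. cmod (f x) \<le> cmod (g x)) \<Longrightarrow> sqnorm M f \<le> sqnorm M g"
  unfolding sqnorm_def by (intro nn_integral_mono ennreal_leI power_mono) auto

text \<open>Slice by slice this is the estimate for the Fourier transform.\<close>

lemma sqnorm_truncated_weyl_kernel_diff:
  fixes f :: "(real ^ 'n) \<times> (real ^ 'n) \<Rightarrow> complex"
  assumes f: "f \<in> L2_space lborel"
  shows "sqnorm lborel (\<lambda>p. truncated_weyl_kernel m f p - truncated_weyl_kernel n f p)
    \<le> sqnorm lborel (\<lambda>p. cutoff (real m) f p - cutoff (real n) f p)"
proof -
  have fm [measurable]: "f \<in> borel_measurable borel" using f by (simp add: L2_space_iff)
  have "sqnorm lborel (\<lambda>p. truncated_weyl_kernel m f p - truncated_weyl_kernel n f p)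
    = (\<integral>\<^sup>+y. sqnorm lborel (\<lambda>\<zeta>. fourier (\<lambda>x. cutoff (real m) f (x, y)) \<zeta> - fourier (\<lambda>x. cutoff (real n) f (x, y)) \<zeta>) \<partial>lborel)"
    unfolding sqnorm_def by (subst nn_integral_shear) (simp_all add: truncated_weyl_kernel_slice)
  also have "\<dots> \<le> (\<integral>\<^sup>+y. sqnorm lborel (\<lambda>x. cutoff (real m) f (x, y) - cutoff (real n) f (x, y)) \<partial>lborel)"
  proof (rule nn_integral_mono_AE, use AE_slice_L2[OF f] in eventually_elim)
    case (elim y)
    have int: "integrable lborel (\<lambda>x. cutoff (real k) f (x, y))" for k
    proof (rule integrable_of_L2_bounded_support[where R = "real k"])
      have "sqnorm lborel (\<lambda>x. cutoff (real k) f (x, y)) \<le> sqnorm lborel (\<lambda>x. f (x, y))"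
        by (rule sqnorm_mono) (simp add: cutoff_def)
      then show "sqnorm lborel (\<lambda>x. cutoff (real k) f (x, y)) < \<infinity>" using elim by (rule le_less_trans)
      show "(\<lambda>x. cutoff (real k) f (x, y)) \<in> borel_measurable borel" by (intro slice_measurable cutoff_measurable fm)
    qed (simp add: cutoff_def)
    show ?case
      unfolding fourier_diff[OF int int]
    proof (rule sqnorm_fourier_le)
      show "(\<lambda>x. cutoff (real m) f (x, y) - cutoff (real n) f (x, y)) \<in> borel_measurable borel"
        by (intro borel_measurable_diff slice_measurable cutoff_measurable fm)
      show "cutoff (real m) f (x, y) - cutoff (real n) f (x, y) = 0" if "norm x \<ge> real (max m n) + 1" for x
        using that by (auto simp: cutoff_def)
    qed simp
  qed
  also have "\<dots> = sqnorm lborel (\<lambda>p. cutoff (real m) f p - cutoff (real n) f p)"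
    by (rule sqnorm_slices[symmetric]) measurable
  finally show ?thesis .
qed

text \<open>The truncated kernels form a Cauchy sequence because the truncated functions do.\<close>

lemma ex_weyl_kernel:
  fixes f :: "(real ^ 'n) \<times> (real ^ 'n) \<Rightarrow> complex"
  assumes f: "f \<in> L2_space lborel"
  shows "\<exists>K. is_weyl_kernel f K"
proof -
  have fm [measurable]: "f \<in> borel_measurable borel" and fin: "sqnorm lborel f < \<infinity>"
    using f by (simp_all add: L2_space_iff)
  have zero: "truncated_weyl_kernel 0 f p = 0" "cutoff (real 0) f p = 0" for p :: "(real ^ 'n) \<times> (real ^ 'n)"
    by (cases p, simp add: truncated_weyl_kernel_eq cutoff_def fourier_def case_prod_beta)+
  have "\<exists>K\<in>L2_space lborel. L2_tendsto lborel (\<lambda>N. truncated_weyl_kernel N f) K"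
  proof (rule L2_complete)
    fix N
    have "sqnorm lborel (truncated_weyl_kernel N f) \<le> sqnorm lborel (cutoff (real N) f)"
      using sqnorm_truncated_weyl_kernel_diff[OF f, of N 0] zero by simp
    also have "\<dots> \<le> sqnorm lborel f" by (rule sqnorm_mono) (auto simp: cutoff_def)
    finally show "sqnorm lborel (truncated_weyl_kernel N f) < \<infinity>" using fin by simp
  next
    have "(\<lambda>N. sqnorm lborel (\<lambda>p. f p - cutoff (real N) f p)) \<longlonglongrightarrow> (\<integral>\<^sup>+p. 0 \<partial>(lborel :: ((real ^ 'n) \<times> (real ^ 'n)) measure))"
      unfolding sqnorm_def
    proof (rule nn_integral_dominated_convergence[where w = "\<lambda>p. ennreal ((cmod (f p))\<^sup>2)"])
      show "AE p in lborel. (\<lambda>N. ennreal ((cmod (f p - cutoff (real N) f p))\<^sup>2)) \<longlonglongrightarrow> 0"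
      proof (intro AE_I2 tendsto_eventually)
        fix p :: "(real ^ 'n) \<times> (real ^ 'n)"
        obtain N0 :: nat where "norm (fst p) < real N0" using reals_Archimedean2 by blast
        show "\<forall>\<^sub>F N in sequentially. ennreal ((cmod (f p - cutoff (real N) f p))\<^sup>2) = 0"
          using eventually_ge_at_top[of N0]
        proof eventually_elim
          case (elim N)
          then have "norm (fst p) < real N" using \<open>norm (fst p) < real N0\<close> by linarith
          then show ?case by (simp add: cutoff_def case_prod_beta)
        qed
      qed
      show "(\<integral>\<^sup>+p. ennreal ((cmod (f p))\<^sup>2) \<partial>lborel) < \<infinity>" using fin by (simp add: sqnorm_def)
      show "AE p in lborel. ennreal ((cmod (f p - cutoff (real N) f p))\<^sup>2) \<le> ennreal ((cmod (f p))\<^sup>2)" for N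
        by (auto simp: cutoff_def)
    qed measurable
    then have tail: "(\<lambda>N. sqnorm lborel (\<lambda>p. f p - cutoff (real N) f p)) \<longlonglongrightarrow> 0" by simp
    fix e :: real assume "e > 0"
    then have "\<forall>\<^sub>F N in sequentially. sqnorm lborel (\<lambda>p. f p - cutoff (real N) f p) < ennreal e"
      using tail by (intro order_tendstoD) auto
    then obtain N where N: "sqnorm lborel (\<lambda>p. f p - cutoff (real N) f p) < ennreal e"
      by (auto simp: eventually_sequentially)
    have "sqnorm lborel (\<lambda>p. truncated_weyl_kernel m f p - truncated_weyl_kernel n f p) \<le> ennreal e"
      if "m \<ge> N" "n \<ge> N" for m n
    proof -
      have "sqnorm lborel (\<lambda>p. cutoff (real m) f p - cutoff (real n) f p) \<le> sqnorm lborel (\<lambda>p. f p - cutoff (real N) f p)"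
        using that by (intro sqnorm_mono) (auto simp: cutoff_def)
      then show ?thesis using sqnorm_truncated_weyl_kernel_diff[OF f, of m n] N
        by (meson less_imp_le order_trans)
    qed
    then show "\<exists>N0. \<forall>m\<ge>N0. \<forall>n\<ge>N0. sqnorm lborel (\<lambda>p. truncated_weyl_kernel m f p - truncated_weyl_kernel n f p) \<le> ennreal e"
      by blast
  qed measurable
  then show ?thesis by (auto simp: is_weyl_kernel_def)
qed

lemma is_weyl_kernel_weyl_kernel:
  "f \<in> L2_space lborel \<Longrightarrow> is_weyl_kernel f (weyl_kernel f)"
  unfolding weyl_kernel_def by (metis ex_weyl_kernel someI_ex)

lemma fourier_translate:
  fixes g :: "real ^ 'n \<Rightarrow> complex"
  assumes [measurable]: "g \<in> borel_measurable borel"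
  shows "fourier (\<lambda>x. g (x - a)) \<zeta> = cis (2 * pi * (a \<bullet> \<zeta>)) * fourier g \<zeta>"
proof -
  have m: "(\<lambda>x. g (x - a) * cis (2 * pi * (x \<bullet> \<zeta>))) \<in> borel_measurable borel"
    by measurable
  have "fourier (\<lambda>x. g (x - a)) \<zeta> = (\<integral>x. g x * cis (2 * pi * ((a + x) \<bullet> \<zeta>)) \<partial>lborel)"
    unfolding fourier_def by (subst integral_affine[OF m, of 1 a]) auto
  also have "\<dots> = (\<integral>x. cis (2 * pi * (a \<bullet> \<zeta>)) * (g x * cis (2 * pi * (x \<bullet> \<zeta>))) \<partial>lborel)"
    by (intro Bochner_Integration.integral_cong refl) (simp add: inner_add_left distrib_left mult_ac flip: cis_mult)
  also have "\<dots> = cis (2 * pi * (a \<bullet> \<zeta>)) * fourier g \<zeta>"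
    unfolding fourier_def by simp
  finally show ?thesis .
qed

lemma twisted_translation_0:
  "twisted_translation k 0 f (x, y) = cis (- pi * (y \<bullet> real_vec k)) * f (x - real_vec k, y)"
  by (simp add: twisted_translation_def cis_conv_exp mult_ac)

lemma twisted_translation_0_measurable [measurable]:
  fixes f :: "(real ^ 'n) \<times> (real ^ 'n) \<Rightarrow> complex"
  assumes "f \<in> borel_measurable borel"
  shows "twisted_translation k 0 f \<in> borel_measurable borel"
proof -
  note [measurable] = borel_pair_measurable[OF assms]
  have 1: "twisted_translation k 0 f = (\<lambda>p. cis (- pi * (snd p \<bullet> real_vec k)) * f (fst p - real_vec k, snd p))"
    by (auto simp: fun_eq_iff twisted_translation_0)
  have 2: "(\<lambda>p. cis (- pi * (snd p \<bullet> real_vec k))) \<in> borel_measurable (borel :: ((real ^ 'n) \<times> (real ^ 'n)) measure)"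
    by (intro borel_measurable_continuous_onI continuous_intros)
  have 3: "(\<lambda>p. f (fst p - real_vec k, snd p)) \<in> borel_measurable borel"
    unfolding borel_prod[symmetric] by measurable
  show ?thesis unfolding 1 by (intro borel_measurable_times 2 3)
qed

text \<open>
  On the slice \<open>y\<close> the point \<open>\<zeta>\<close> corresponds to \<open>\<xi> = \<zeta> - y/2\<close>.  The part \<open>\<zeta>\<close> of the frequency of a
  character becomes a translation of \<open>h\<close>, and the part \<open>- y/2\<close> becomes the phase of the twisted
  translation.
\<close>

lemma trig_times_fourier:
  fixes h :: "real ^ 'n \<Rightarrow> complex"
  assumes hm: "h \<in> borel_measurable borel" and h: "integrable lborel h" and F: "finite F"
  shows "trig F c (\<zeta> - (1/2) *\<^sub>R y) * fourier h \<zeta>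
    = fourier (\<lambda>x. \<Sum>k\<in>F. c k * (cis (- pi * (y \<bullet> real_vec k)) * h (x - real_vec k))) \<zeta>"
proof -
  have int: "integrable lborel (\<lambda>x. h (x - a) * cis (2 * pi * (x \<bullet> \<zeta>)))" for a
  proof (rule Bochner_Integration.integrable_bound)
    show "integrable lborel (\<lambda>x. h (x - a))"
    proof (rule integrableI_bounded)
      show "(\<lambda>x. h (x - a)) \<in> borel_measurable lborel" using hm by measurable
      have "(\<integral>\<^sup>+x. ennreal (cmod (h (x - a))) \<partial>lborel) = (\<integral>\<^sup>+x. ennreal (cmod (h x)) \<partial>lborel)"
        using nn_integral_translate[of "\<lambda>x. ennreal (cmod (h x))" "- a"] hm by simp
      then show "(\<integral>\<^sup>+x. ennreal (cmod (h (x - a))) \<partial>lborel) < \<infinity>"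
        using h by (simp add: integrable_iff_bounded)
    qed
    have "(\<lambda>x. h (x - a) * cis (2 * pi * (x \<bullet> \<zeta>))) \<in> borel_measurable borel"
      using hm by measurable
    then show "(\<lambda>x. h (x - a) * cis (2 * pi * (x \<bullet> \<zeta>))) \<in> borel_measurable lborel" by simp
  qed (simp add: norm_mult)
  have "fourier (\<lambda>x. \<Sum>k\<in>F. c k * (cis (- pi * (y \<bullet> real_vec k)) * h (x - real_vec k))) \<zeta>
     = (\<integral>x. (\<Sum>k\<in>F. (c k * cis (- pi * (y \<bullet> real_vec k))) * (h (x - real_vec k) * cis (2 * pi * (x \<bullet> \<zeta>)))) \<partial>lborel)"
    by (simp add: fourier_def sum_distrib_right mult.assoc)
  also have "\<dots> = (\<Sum>k\<in>F. (c k * cis (- pi * (y \<bullet> real_vec k))) * fourier (\<lambda>x. h (x - real_vec k)) \<zeta>)"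
    unfolding fourier_def by (subst Bochner_Integration.integral_sum) (auto intro!: integrable_mult_right int)
  also have "\<dots> = (\<Sum>k\<in>F. (c k * character k (\<zeta> - (1/2) *\<^sub>R y)) * fourier h \<zeta>)"
  proof (intro sum.cong refl)
    fix k
    have "2 * pi * ((\<zeta> - (1/2) *\<^sub>R y) \<bullet> real_vec k) = - pi * (y \<bullet> real_vec k) + 2 * pi * (real_vec k \<bullet> \<zeta>)"
      by (simp add: inner_diff_left algebra_simps inner_commute)
    then have "character k (\<zeta> - (1/2) *\<^sub>R y) = cis (- pi * (y \<bullet> real_vec k)) * cis (2 * pi * (real_vec k \<bullet> \<zeta>))"
      unfolding character_def cis_mult by simp
    then show "(c k * cis (- pi * (y \<bullet> real_vec k))) * fourier (\<lambda>x. h (x - real_vec k)) \<zeta>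
      = (c k * character k (\<zeta> - (1/2) *\<^sub>R y)) * fourier h \<zeta>"
      by (simp add: fourier_translate[OF hm])
  qed
  finally show ?thesis by (simp add: trig_def sum_distrib_right)
qed

text \<open>
  Translating after the cutoff keeps the support bounded, so that multiplication by a trigonometric
  polynomial corresponds exactly to a combination of twisted translates.
\<close>

lemma sqnorm_trig_truncated_weyl_kernel_le:
  fixes f :: "(real ^ 'n) \<times> (real ^ 'n) \<Rightarrow> complex"
  assumes f: "f \<in> L2_space lborel" and F: "finite F"
  shows "sqnorm lborel (\<lambda>p. trig F c (fst p) * truncated_weyl_kernel N f p)
    \<le> sqnorm lborel (\<lambda>p. \<Sum>k\<in>F. c k * twisted_translation k 0 (cutoff (real N) f) p)"
proof -
  have fm [measurable]: "f \<in> borel_measurable borel" using f by (simp add: L2_space_iff)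
  have trig_fst [measurable]: "(\<lambda>p. trig F c (fst p)) \<in> borel_measurable (borel :: ((real ^ 'n) \<times> (real ^ 'n)) measure)"
    unfolding borel_prod[symmetric] by measurable
  have "sqnorm lborel (\<lambda>p. trig F c (fst p) * truncated_weyl_kernel N f p)
    = (\<integral>\<^sup>+y. sqnorm lborel (\<lambda>\<zeta>. trig F c (\<zeta> - (1/2) *\<^sub>R y) * fourier (\<lambda>x. cutoff (real N) f (x, y)) \<zeta>) \<partial>lborel)"
    unfolding sqnorm_def by (subst nn_integral_shear) (simp_all add: truncated_weyl_kernel_slice)
  also have "\<dots> \<le> (\<integral>\<^sup>+y. sqnorm lborel (\<lambda>x. \<Sum>k\<in>F. c k * twisted_translation k 0 (cutoff (real N) f) (x, y)) \<partial>lborel)"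
  proof (rule nn_integral_mono_AE, use AE_slice_L2[OF f] in eventually_elim)
    case (elim y)
    have m: "(\<lambda>x. cutoff (real N) f (x, y)) \<in> borel_measurable borel" by (intro slice_measurable cutoff_measurable fm)
    have int: "integrable lborel (\<lambda>x. cutoff (real N) f (x, y))"
    proof (rule integrable_of_L2_bounded_support[OF m, where R = "real N"])
      have "sqnorm lborel (\<lambda>x. cutoff (real N) f (x, y)) \<le> sqnorm lborel (\<lambda>x. f (x, y))"
        by (rule sqnorm_mono) (simp add: cutoff_def)
      then show "sqnorm lborel (\<lambda>x. cutoff (real N) f (x, y)) < \<infinity>" using elim by (rule le_less_trans)
    qed (simp add: cutoff_def)
    show ?case
      unfolding trig_times_fourier[OF m int F] twisted_translation_0
    proof (rule sqnorm_fourier_le)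
      show "(\<lambda>x. \<Sum>k\<in>F. c k * (cis (- pi * (y \<bullet> real_vec k)) * cutoff (real N) f (x - real_vec k, y))) \<in> borel_measurable borel"
        using m by measurable
      define R where "R = real N + (\<Sum>k\<in>F. norm (real_vec k)) + 1"
      show "R > 0" by (simp add: R_def add_nonneg_pos sum_nonneg)
      show "(\<Sum>k\<in>F. c k * (cis (- pi * (y \<bullet> real_vec k)) * cutoff (real N) f (x - real_vec k, y))) = 0"
        if x: "norm x \<ge> R" for x
      proof (intro sum.neutral ballI)
        fix k assume k: "k \<in> F"
        have "norm (real_vec k) \<le> (\<Sum>k\<in>F. norm (real_vec k))"
          using k F by (intro member_le_sum[of k F "\<lambda>k. norm (real_vec k)"]) auto
        then have "norm (x - real_vec k) \<ge> real N"
          using x norm_triangle_ineq2[of x "real_vec k"] unfolding R_def by linarith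
        then show "c k * (cis (- pi * (y \<bullet> real_vec k)) * cutoff (real N) f (x - real_vec k, y)) = 0"
          by (simp add: cutoff_def)
      qed
    qed
  qed
  also have "\<dots> = sqnorm lborel (\<lambda>p. \<Sum>k\<in>F. c k * twisted_translation k 0 (cutoff (real N) f) p)"
    by (rule sqnorm_slices[symmetric]) measurable
  finally show ?thesis .
qed

section \<open>From trigonometric polynomials to almost every point\<close>

definition trigonometric :: "(real ^ 'n \<Rightarrow> complex) \<Rightarrow> bool" where
  "trigonometric g \<longleftrightarrow> (\<exists>F c. finite F \<and> g = trig F c)"

lemma trigonometric_character: "trigonometric (\<lambda>x. a * character k x)"
  unfolding trigonometric_def by (intro exI[of _ "{k}"] exI[of _ "\<lambda>_. a"]) (auto simp: trig_def)

lemma trigonometric_const: "trigonometric (\<lambda>x. a)"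
  using trigonometric_character[of a 0] by simp

lemma trigonometric_add:
  assumes "trigonometric g" "trigonometric h"
  shows "trigonometric (\<lambda>x. g x + h x)"
proof -
  obtain F c G d where *: "finite F" "g = trig F c" "finite G" "h = trig G d"
    using assms by (auto simp: trigonometric_def)
  let ?e = "\<lambda>k. (if k \<in> F then c k else 0) + (if k \<in> G then d k else 0)"
  have "g x + h x = trig (F \<union> G) ?e x" for x
  proof -
    have "g x = (\<Sum>k\<in>F \<union> G. (if k \<in> F then c k else 0) * character k x)"
      unfolding * trig_def using * by (intro sum.mono_neutral_cong_left) auto
    moreover have "h x = (\<Sum>k\<in>F \<union> G. (if k \<in> G then d k else 0) * character k x)"
      unfolding * trig_def using * by (intro sum.mono_neutral_cong_left) auto
    ultimately show ?thesis by (simp add: trig_def distrib_right sum.distrib)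
  qed
  then show ?thesis
    unfolding trigonometric_def using * by (intro exI[of _ "F \<union> G"] exI[of _ ?e]) auto
qed

lemma trigonometric_sum:
  "(\<And>i. i \<in> I \<Longrightarrow> trigonometric (g i)) \<Longrightarrow> trigonometric (\<lambda>x. \<Sum>i\<in>I. g i x)"
  by (induction I rule: infinite_finite_induct) (auto intro: trigonometric_add trigonometric_const)

lemma trigonometric_mult:
  assumes "trigonometric g" "trigonometric h"
  shows "trigonometric (\<lambda>x. g x * h x)"
proof -
  obtain F c G d where *: "finite F" "g = trig F c" "finite G" "h = trig G d"
    using assms by (auto simp: trigonometric_def)
  have "(\<lambda>x. g x * h x) = (\<lambda>x. \<Sum>k\<in>F. \<Sum>l\<in>G. (c k * d l) * character (k + l) x)"
    by (simp add: * trig_def sum_product character_add mult_ac)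
  moreover have "trigonometric (\<lambda>x. \<Sum>k\<in>F. \<Sum>l\<in>G. (c k * d l) * character (k + l) x)"
    by (intro trigonometric_sum trigonometric_character)
  ultimately show ?thesis by simp
qed

text \<open>
  The torus as the product of unit circles in a Euclidean space.  Polynomials on that space restrict
  to trigonometric polynomials, and a function that is continuous there restricts to one that is
  continuous on the torus, with opposite faces of the cube identified.
\<close>

definition torus_embedding :: "real ^ 'n \<Rightarrow> complex ^ 'n" where
  "torus_embedding x = (\<chi> i. cis (2 * pi * x $ i))"

lemma continuous_torus_embedding: "continuous_on S torus_embedding"
  unfolding torus_embedding_def by (intro continuous_intros)

lemma torus_embedding_measurable [measurable]: "torus_embedding \<in> measurable borel borel"
  by (intro borel_measurable_continuous_onI continuous_torus_embedding)

text \<open>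
  A Borel left inverse of the embedding on the half-open cube; by it every Borel subset of the cube
  is the preimage of a Borel subset of the ambient space.
\<close>

definition torus_coordinates :: "complex ^ 'n \<Rightarrow> real ^ 'n" where
  "torus_coordinates z = (\<chi> i. Arg2pi (z $ i) / (2 * pi))"

lemma Arg2pi_measurable [measurable]: "Arg2pi \<in> borel_measurable borel"
proof -
  have "(\<lambda>z. indicator (- \<real>\<^sub>\<ge>\<^sub>0) z *\<^sub>R Arg2pi z) \<in> borel_measurable borel"
    by (intro borel_measurable_continuous_on_indicator continuous_at_imp_continuous_on)
       (auto intro: continuous_at_Arg2pi)
  moreover have "(\<lambda>z. indicator (- \<real>\<^sub>\<ge>\<^sub>0) z *\<^sub>R Arg2pi z) = Arg2pi"
    using Arg2pi_eq_0 by (auto simp: fun_eq_iff indicator_def complex_nonneg_Reals_iff complex_is_Real_iff)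
  ultimately show ?thesis by simp
qed

lemma torus_coordinates_measurable [measurable]: "torus_coordinates \<in> measurable borel borel"
proof (rule borel_measurable_euclidean_space[THEN iffD2], intro ballI)
  fix b :: "real ^ 'n" assume "b \<in> Basis"
  then obtain i where b: "b = axis i 1" by (auto simp: Basis_vec_def)
  have [measurable]: "(\<lambda>z :: complex ^ 'n. z $ i) \<in> borel_measurable borel"
    by (intro borel_measurable_continuous_onI continuous_intros)
  have "(\<lambda>z. torus_coordinates z \<bullet> b) = (\<lambda>z. Arg2pi (z $ i) / (2 * pi))"
    by (simp add: b inner_axis torus_coordinates_def)
  then show "(\<lambda>z. torus_coordinates z \<bullet> b) \<in> borel_measurable borel" by simp
qed

lemma torus_coordinates_embedding:
  assumes "x \<in> unit_cube"
  shows "torus_coordinates (torus_embedding x) = x"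
proof -
  have "Arg2pi (cis (2 * pi * x $ i)) = 2 * pi * x $ i" for i
  proof (rule Arg2pi_unique[where r = 1])
    show "0 \<le> 2 * pi * x $ i" "2 * pi * x $ i < 2 * pi" using assms by (auto simp: unit_cube_def)
  qed (auto simp: cis_conv_exp)
  then show ?thesis by (simp add: torus_coordinates_def torus_embedding_def vec_eq_iff)
qed

text \<open>
  A linear functional of the embedded point is a combination of the coordinates' cosines and sines,
  and these are Euler combinations of two characters.
\<close>

lemma trigonometric_linear:
  fixes f :: "complex ^ 'n \<Rightarrow> real"
  assumes "bounded_linear f"
  shows "trigonometric (\<lambda>x. complex_of_real (f (torus_embedding x)))"
proof -
  interpret f: bounded_linear f by fact
  have "torus_embedding x = (\<Sum>i\<in>UNIV. cos (2 * pi * x $ i) *\<^sub>R axis i 1 + sin (2 * pi * x $ i) *\<^sub>R axis i \<i>)" for x :: "real ^ 'n"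
  proof -
    have "(\<Sum>i\<in>UNIV. cos (2 * pi * x $ i) *\<^sub>R axis i 1 + sin (2 * pi * x $ i) *\<^sub>R axis i \<i>) $ j
      = (\<Sum>i\<in>UNIV. if i = j then cis (2 * pi * x $ j) else 0)" for j
      unfolding sum_component by (intro sum.cong refl) (auto simp: axis_def complex_eq_iff)
    then show ?thesis by (simp add: vec_eq_iff torus_embedding_def)
  qed
  then have f_eq: "f (torus_embedding x) = (\<Sum>i\<in>UNIV. cos (2 * pi * x $ i) * f (axis i 1) + sin (2 * pi * x $ i) * f (axis i \<i>))" for x
    by (simp add: f.sum f.add f.scaleR)
  have char: "character (axis i 1) x = cis (2 * pi * x $ i)" "character (- axis i 1) x = cis (- (2 * pi * x $ i))" for i x
  proof -
    have "real_vec (axis i 1) = axis i 1" by (simp add: vec_eq_iff axis_def)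
    then show "character (axis i 1) x = cis (2 * pi * x $ i)" "character (- axis i 1) x = cis (- (2 * pi * x $ i))"
      by (simp_all add: character_def real_vec_minus inner_axis)
  qed
  have cos_eq: "complex_of_real (cos (2 * pi * x $ i)) = 1/2 * character (axis i 1) x + 1/2 * character (- axis i 1) x"
    and sin_eq: "complex_of_real (sin (2 * pi * x $ i)) = (- \<i>/2) * character (axis i 1) x + (\<i>/2) * character (- axis i 1) x" for i x
    by (simp_all add: char complex_eq_iff)
  show ?thesis
    unfolding f_eq of_real_sum of_real_add of_real_mult cos_eq sin_eq
    by (intro trigonometric_sum trigonometric_add trigonometric_mult trigonometric_character trigonometric_const)
qed

lemma trigonometric_real_polynomial:
  fixes p :: "complex ^ 'n \<Rightarrow> real"
  assumes "real_polynomial_function p"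
  shows "trigonometric (\<lambda>x. complex_of_real (p (torus_embedding x)))"
  using assms
  by (induction p rule: real_polynomial_function.induct)
     (auto intro: trigonometric_linear trigonometric_const trigonometric_add trigonometric_mult)

lemma weighted_bound_limit:
  fixes H :: "nat \<Rightarrow> real ^ 'n \<Rightarrow> real"
  assumes [measurable]: "\<And>j. H j \<in> borel_measurable borel" "h \<in> borel_measurable borel" "w \<in> borel_measurable borel"
    and w: "(\<integral>\<^sup>+x. w x \<partial>torus) < \<infinity>"
    and bound: "\<And>j x. x \<in> unit_cube \<Longrightarrow> \<bar>H j x\<bar> \<le> C"
    and lim: "\<And>x. x \<in> unit_cube \<Longrightarrow> (\<lambda>j. H j x) \<longlonglongrightarrow> h x"
    and le: "\<And>j. (\<integral>\<^sup>+x. ennreal ((H j x)\<^sup>2) * w x \<partial>torus) \<le> ennreal B * (\<integral>\<^sup>+x. ennreal ((H j x)\<^sup>2) \<partial>torus)"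
  shows "(\<integral>\<^sup>+x. ennreal ((h x)\<^sup>2) * w x \<partial>torus) \<le> ennreal B * (\<integral>\<^sup>+x. ennreal ((h x)\<^sup>2) \<partial>torus)"
proof -
  have sq: "(H j x)\<^sup>2 \<le> C\<^sup>2" if "x \<in> unit_cube" for j x
    using bound[OF that, of j] by (metis abs_ge_zero abs_le_square_iff abs_of_nonneg order_trans)
  have w_fin: "AE x in torus. w x \<noteq> \<infinity>"
    using w by (intro nn_integral_PInf_AE) auto
  have "(\<lambda>j. \<integral>\<^sup>+x. ennreal ((H j x)\<^sup>2) * w x \<partial>torus) \<longlonglongrightarrow> (\<integral>\<^sup>+x. ennreal ((h x)\<^sup>2) * w x \<partial>torus)"
  proof (rule nn_integral_dominated_convergence[where w = "\<lambda>x. ennreal (C\<^sup>2) * w x"])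
    show "AE x in torus. ennreal ((H j x)\<^sup>2) * w x \<le> ennreal (C\<^sup>2) * w x" for j
      by (intro AE_I2 mult_right_mono ennreal_leI sq) (auto simp: space_torus)
    show "(\<integral>\<^sup>+x. ennreal (C\<^sup>2) * w x \<partial>torus) < \<infinity>"
      using w by (simp add: nn_integral_cmult ennreal_mult_less_top)
    show "AE x in torus. (\<lambda>j. ennreal ((H j x)\<^sup>2) * w x) \<longlonglongrightarrow> ennreal ((h x)\<^sup>2) * w x"
      using w_fin AE_space
      by eventually_elim (intro tendsto_mult_ennreal tendsto_const tendsto_ennrealI tendsto_power lim, auto simp: space_torus)
  qed measurable
  moreover have "(\<lambda>j. \<integral>\<^sup>+x. ennreal ((H j x)\<^sup>2) \<partial>torus) \<longlonglongrightarrow> (\<integral>\<^sup>+x. ennreal ((h x)\<^sup>2) \<partial>torus)"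
  proof (rule nn_integral_dominated_convergence[where w = "\<lambda>x. ennreal (C\<^sup>2)"])
    show "AE x in torus. ennreal ((H j x)\<^sup>2) \<le> ennreal (C\<^sup>2)" for j
      by (intro AE_I2 ennreal_leI sq) (auto simp: space_torus)
    show "(\<integral>\<^sup>+x. ennreal (C\<^sup>2) \<partial>(torus :: (real ^ 'n) measure)) < \<infinity>"
      by (simp add: emeasure_torus)
    show "AE x in torus. (\<lambda>j. ennreal ((H j x)\<^sup>2)) \<longlonglongrightarrow> ennreal ((h x)\<^sup>2)"
      by (intro AE_I2 tendsto_ennrealI tendsto_power lim) (auto simp: space_torus)
  qed measurable
  then have "(\<lambda>j. ennreal B * (\<integral>\<^sup>+x. ennreal ((H j x)\<^sup>2) \<partial>torus)) \<longlonglongrightarrow> ennreal B * (\<integral>\<^sup>+x. ennreal ((h x)\<^sup>2) \<partial>torus)"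
    by (intro ennreal_tendsto_cmult) auto
  ultimately show ?thesis
    by (rule LIMSEQ_le) (use le in auto)
qed

text \<open>By the Stone--Weierstrass theorem on the embedded torus.\<close>

lemma weighted_bound_continuous:
  fixes w :: "real ^ 'n \<Rightarrow> ennreal" and h :: "complex ^ 'n \<Rightarrow> real"
  assumes wm [measurable]: "w \<in> borel_measurable borel"
    and w: "(\<integral>\<^sup>+x. w x \<partial>torus) < \<infinity>"
    and trig: "\<And>F c. finite F \<Longrightarrow>
      (\<integral>\<^sup>+x. ennreal ((cmod (trig F c x))\<^sup>2) * w x \<partial>torus) \<le> ennreal B * sqnorm torus (trig F c)"
    and h: "continuous_on UNIV h"
  shows "(\<integral>\<^sup>+x. ennreal ((h (torus_embedding x))\<^sup>2) * w x \<partial>torus)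
    \<le> ennreal B * (\<integral>\<^sup>+x. ennreal ((h (torus_embedding x))\<^sup>2) \<partial>torus)"
proof -
  define S where "S = torus_embedding ` cbox (0 :: real ^ 'n) 1"
  have S: "compact S" unfolding S_def by (intro compact_continuous_image continuous_torus_embedding compact_cbox)
  have in_S: "torus_embedding x \<in> S" if "x \<in> unit_cube" for x
    using that by (auto simp: S_def unit_cube_def mem_box_cart less_imp_le)
  have hS: "continuous_on S h" using h continuous_on_subset by blast
  have "bounded (h ` S)" using hS S by (intro compact_imp_bounded compact_continuous_image)
  then obtain C where C: "\<And>z. z \<in> S \<Longrightarrow> \<bar>h z\<bar> \<le> C" by (auto simp: bounded_iff)
  have "\<exists>p. real_polynomial_function p \<and> (\<forall>z\<in>S. \<bar>h z - p z\<bar> < 1 / real (Suc j))" for j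
    using Stone_Weierstrass_real_polynomial_function[OF S hS, of "1 / real (Suc j)"] by (metis of_nat_0_less_iff zero_less_Suc zero_less_divide_1_iff)
  then obtain p where p: "\<And>j. real_polynomial_function (p j)" "\<And>j z. z \<in> S \<Longrightarrow> \<bar>h z - p j z\<bar> < 1 / real (Suc j)" by metis
  have [measurable]: "p j \<in> borel_measurable borel" for j
    using p(1)[of j] by (intro borel_measurable_continuous_onI continuous_on_polymonial_function)
      (simp add: real_polynomial_function_eq)
  have [measurable]: "h \<in> borel_measurable borel" using h by (rule borel_measurable_continuous_onI)
  show ?thesis
  proof (rule weighted_bound_limit[where H = "\<lambda>j x. p j (torus_embedding x)" and C = "C + 1"])
    fix j
    obtain F c where F: "finite F" "(\<lambda>x. complex_of_real (p j (torus_embedding x))) = trig F c"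
      using trigonometric_real_polynomial[OF p(1)[of j]] by (auto simp: trigonometric_def)
    have "(p j (torus_embedding x))\<^sup>2 = (cmod (trig F c x))\<^sup>2" for x
      unfolding F(2)[symmetric] by simp
    then show "(\<integral>\<^sup>+x. ennreal ((p j (torus_embedding x))\<^sup>2) * w x \<partial>torus)
        \<le> ennreal B * (\<integral>\<^sup>+x. ennreal ((p j (torus_embedding x))\<^sup>2) \<partial>torus)"
      using trig[OF F(1), of c] by (simp add: sqnorm_def)
  next
    fix j :: nat and x :: "real ^ 'n" assume x: "x \<in> unit_cube"
    have "1 / real (Suc j) \<le> 1" by simp
    then show "\<bar>p j (torus_embedding x)\<bar> \<le> C + 1"
      using C[OF in_S[OF x]] p(2)[OF in_S[OF x], of j] by linarith
  next
    fix x :: "real ^ 'n" assume x: "x \<in> unit_cube"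
    have "(\<lambda>j. h (torus_embedding x) - p j (torus_embedding x)) \<longlonglongrightarrow> 0"
    proof (rule Lim_null_comparison)
      show "\<forall>\<^sub>F j in sequentially. norm (h (torus_embedding x) - p j (torus_embedding x)) \<le> 1 / real (Suc j)"
        using p(2)[OF in_S[OF x]] by (auto intro!: always_eventually less_imp_le)
      show "(\<lambda>j. 1 / real (Suc j)) \<longlonglongrightarrow> 0" by (rule LIMSEQ_Suc[OF lim_const_over_n])
    qed
    then have "(\<lambda>j. h (torus_embedding x) - (h (torus_embedding x) - p j (torus_embedding x))) \<longlonglongrightarrow> h (torus_embedding x) - 0"
      by (intro tendsto_intros)
    then show "(\<lambda>j. p j (torus_embedding x)) \<longlonglongrightarrow> h (torus_embedding x)" by simp
  qed (use w in measurable)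
qed

text \<open>The indicator of \<open>V\<close> is the limit of \<open>min 1 (j d)\<close>, where \<open>d\<close> is the distance from the complement.\<close>

lemma weighted_bound_open:
  fixes w :: "real ^ 'n \<Rightarrow> ennreal" and V :: "(complex ^ 'n) set"
  assumes wm [measurable]: "w \<in> borel_measurable borel"
    and w: "(\<integral>\<^sup>+x. w x \<partial>torus) < \<infinity>"
    and trig: "\<And>F c. finite F \<Longrightarrow>
      (\<integral>\<^sup>+x. ennreal ((cmod (trig F c x))\<^sup>2) * w x \<partial>torus) \<le> ennreal B * sqnorm torus (trig F c)"
    and V: "open V"
  shows "(\<integral>\<^sup>+x. indicator V (torus_embedding x) * w x \<partial>torus)
    \<le> ennreal B * (\<integral>\<^sup>+x. indicator V (torus_embedding x) \<partial>torus)"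
proof -
  \<comment> \<open>The embedded torus avoids 0; adding it makes the distance meaningful when \<open>V\<close> is the whole space.\<close>
  define T where "T = insert 0 (- V)"
  define h where "h j z = min 1 (real j * infdist z T)" for j z
  have T: "closed T" "T \<noteq> {}" using V by (auto simp: T_def intro!: closed_insert)
  have h_cont: "continuous_on UNIV (h j)" for j
    unfolding h_def by (intro continuous_intros)
  have [measurable]: "h j \<in> borel_measurable borel" for j
    using h_cont by (rule borel_measurable_continuous_onI)
  have [measurable]: "V \<in> sets borel" using V by simp
  have nz: "torus_embedding x \<noteq> 0" for x :: "real ^ 'n"
  proof
    assume "torus_embedding x = 0"
    then have "torus_embedding x $ undefined = 0" by simp
    then show False by (simp add: torus_embedding_def)
  qed
  have "(\<integral>\<^sup>+x. ennreal ((indicat_real V (torus_embedding x))\<^sup>2) * w x \<partial>torus)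
    \<le> ennreal B * (\<integral>\<^sup>+x. ennreal ((indicat_real V (torus_embedding x))\<^sup>2) \<partial>torus)"
  proof (rule weighted_bound_limit[where H = "\<lambda>j x. h j (torus_embedding x)" and C = 1])
    fix j
    show "(\<integral>\<^sup>+x. ennreal ((h j (torus_embedding x))\<^sup>2) * w x \<partial>torus)
        \<le> ennreal B * (\<integral>\<^sup>+x. ennreal ((h j (torus_embedding x))\<^sup>2) \<partial>torus)"
      by (rule weighted_bound_continuous[OF wm w trig h_cont])
    show "\<bar>h j (torus_embedding x)\<bar> \<le> 1" for x :: "real ^ 'n"
      using infdist_nonneg[of "torus_embedding x" T] by (auto simp: h_def)
  next
    fix x :: "real ^ 'n"
    let ?z = "torus_embedding x"
    show "(\<lambda>j. h j ?z) \<longlonglongrightarrow> indicat_real V ?z"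
    proof (cases "?z \<in> V")
      case True
      then have "?z \<notin> T" using nz by (simp add: T_def)
      then have pos: "infdist ?z T > 0"
        using T in_closed_iff_infdist_zero[of T ?z] infdist_nonneg[of ?z T] by linarith
      obtain N :: nat where N: "1 / infdist ?z T < real N" using reals_Archimedean2 by blast
      have "\<forall>\<^sub>F j in sequentially. h j ?z = 1"
        using eventually_ge_at_top[of N]
      proof eventually_elim
        case (elim j)
        then have "1 / infdist ?z T \<le> real j" using N by linarith
        then have "1 \<le> real j * infdist ?z T" using pos by (simp add: field_simps)
        then show ?case by (simp add: h_def)
      qed
      then show ?thesis using True by (simp add: tendsto_eventually)
    next
      case False
      then have "h j ?z = 0" for j by (simp add: h_def T_def)
      then show ?thesis using False by simp
    qed
  qed (use w in measurable)
  moreover have "ennreal ((indicat_real V z)\<^sup>2) = indicator V z" for z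
    by (simp add: indicator_def)
  ultimately show ?thesis by simp
qed

text \<open>
  Outer regularity of the image of Lebesgue measure extends the bound from open sets to Borel sets.
  Applied to the set where \<open>w > B\<close> it leaves no room for a positive integral of \<open>w - B\<close>.
\<close>

lemma AE_le_of_trig_bound:
  fixes w :: "real ^ 'n \<Rightarrow> ennreal"
  assumes wm [measurable]: "w \<in> borel_measurable borel"
    and w: "(\<integral>\<^sup>+x. w x \<partial>torus) < \<infinity>"
    and B: "B > 0"
    and trig: "\<And>F c. finite F \<Longrightarrow>
      (\<integral>\<^sup>+x. ennreal ((cmod (trig F c x))\<^sup>2) * w x \<partial>torus) \<le> ennreal B * sqnorm torus (trig F c)"
  shows "AE x in torus. w x \<le> ennreal B"
proof -
  define \<nu> where "\<nu> = distr (torus :: (real ^ 'n) measure) borel torus_embedding"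
  have \<nu>: "emeasure \<nu> A = (\<integral>\<^sup>+x. indicator A (torus_embedding x) \<partial>torus)" if [measurable]: "A \<in> sets borel" for A
  proof -
    have "emeasure \<nu> A = (\<integral>\<^sup>+z. indicator A z \<partial>\<nu>)"
      by (rule nn_integral_indicator[symmetric]) (simp add: \<nu>_def)
    also have "\<dots> = (\<integral>\<^sup>+x. indicator A (torus_embedding x) \<partial>torus)"
      unfolding \<nu>_def by (rule nn_integral_distr) measurable
    finally show ?thesis .
  qed
  have fin: "emeasure \<nu> (space \<nu>) \<noteq> \<infinity>"
  proof -
    have "emeasure \<nu> (space \<nu>) = emeasure (torus :: (real ^ 'n) measure) (space torus)"
      using \<nu>[of UNIV] by (simp add: \<nu>_def)
    then show ?thesis by (simp add: emeasure_torus)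
  qed
  have Borel: "(\<integral>\<^sup>+x. indicator A (torus_embedding x) * w x \<partial>torus) \<le> ennreal B * emeasure \<nu> A"
    if A: "A \<in> sets borel" for A
  proof -
    let ?I = "\<integral>\<^sup>+x. indicator A (torus_embedding x) * w x \<partial>torus"
    have inv: "ennreal (1 / B) * ennreal B = 1" using B by (simp flip: ennreal_mult)
    have "ennreal (1 / B) * ?I \<le> (INF U\<in>{U. A \<subseteq> U \<and> open U}. emeasure \<nu> U)"
    proof (intro INF_greatest)
      fix U assume "U \<in> {U. A \<subseteq> U \<and> open U}"
      then have U: "A \<subseteq> U" "open U" by auto
      have "?I \<le> (\<integral>\<^sup>+x. indicator U (torus_embedding x) * w x \<partial>torus)"
        using U(1) by (intro nn_integral_mono mult_right_mono) (auto split: split_indicator)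
      also have "\<dots> \<le> ennreal B * emeasure \<nu> U"
        using weighted_bound_open[OF wm w trig U(2)] U(2) by (simp add: \<nu>)
      finally have "ennreal (1 / B) * ?I \<le> ennreal (1 / B) * (ennreal B * emeasure \<nu> U)"
        by (rule mult_left_mono) simp
      then show "ennreal (1 / B) * ?I \<le> emeasure \<nu> U"
        by (simp only: mult.assoc[symmetric] inv mult_1_left)
    qed
    also have "\<dots> = emeasure \<nu> A"
      by (rule outer_regular[symmetric, OF _ fin A]) (simp add: \<nu>_def)
    finally have "ennreal B * (ennreal (1 / B) * ?I) \<le> ennreal B * emeasure \<nu> A"
      by (rule mult_left_mono) simp
    then show ?thesis
      using inv by (simp only: mult.assoc[symmetric] mult.commute[of "ennreal B"] mult_1_left) 
  qed
  define A where "A = {z :: complex ^ 'n. w (torus_coordinates z) > ennreal B}"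
  have A [measurable]: "A \<in> sets borel" unfolding A_def by measurable
  have in_A: "torus_embedding x \<in> A \<longleftrightarrow> w x > ennreal B" if "x \<in> space torus" for x
    using that by (simp add: A_def torus_coordinates_embedding space_torus)
  let ?i = "\<lambda>x. indicator A (torus_embedding x) :: ennreal"
  have "(\<integral>\<^sup>+x. ?i x * (w x - ennreal B) \<partial>torus) + ennreal B * emeasure \<nu> A
      = (\<integral>\<^sup>+x. ?i x * (w x - ennreal B) + ennreal B * ?i x \<partial>torus)"
    by (simp add: \<nu> nn_integral_add nn_integral_cmult)
  also have "\<dots> = (\<integral>\<^sup>+x. ?i x * w x \<partial>torus)"
    using in_A by (intro nn_integral_cong) (auto split: split_indicator intro!: diff_add_cancel_ennreal less_imp_le)
  also have "\<dots> \<le> ennreal B * emeasure \<nu> A" by (rule Borel[OF A])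
  finally have le: "(\<integral>\<^sup>+x. ?i x * (w x - ennreal B) \<partial>torus) + ennreal B * emeasure \<nu> A \<le> 0 + ennreal B * emeasure \<nu> A" by simp
  have "emeasure \<nu> A < top"
    using fin emeasure_space[of \<nu> A] by (simp add: less_top top.not_eq_extremum le_less_trans)
  then have "ennreal B * emeasure \<nu> A \<noteq> top" by (simp add: ennreal_mult_eq_top_iff)
  then have "(\<integral>\<^sup>+x. ?i x * (w x - ennreal B) \<partial>torus) = 0"
    using le by (simp add: add.commute[of _ "ennreal B * _"] ennreal_add_left_cancel_le)
  then have "AE x in torus. ?i x * (w x - ennreal B) = 0"
    by (subst (asm) nn_integral_0_iff_AE) auto
  then show ?thesis
    using AE_space
  proof eventually_elim
    case (elim x)
    show ?case
    proof (rule ccontr)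
      assume "\<not> ?case"
      then have gt: "ennreal B < w x" by simp
      then have "w x - ennreal B = 0" using elim in_A[of x] by simp
      then show False using gt by (metis diff_eq_0_iff_ennreal ennreal_less_top leD)
    qed
  qed
qed

section \<open>The periodized fibre norm of the kernel\<close>

text \<open>The summand of the periodization that defines \<^const>\<open>w_fun\<close>.\<close>

definition fibre_norm :: "((real ^ 'n) \<times> (real ^ 'n) \<Rightarrow> complex) \<Rightarrow> real ^ 'n \<Rightarrow> ennreal" where
  "fibre_norm K \<xi> = (\<integral>\<^sup>+\<eta>. ennreal ((cmod (K (\<xi>, \<eta>)))\<^sup>2) \<partial>lborel)"

lemma fibre_norm_measurable [measurable]:
  fixes K :: "(real ^ 'n) \<times> (real ^ 'n) \<Rightarrow> complex"
  assumes "K \<in> borel_measurable borel"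
  shows "fibre_norm K \<in> borel_measurable borel"
proof -
  note [measurable] = borel_pair_measurable[OF assms]
  show ?thesis unfolding fibre_norm_def by measurable
qed

lemma w_fun_eq: "w_fun \<phi> \<xi> = (\<Sum>\<^sub>\<infinity>m. fibre_norm (weyl_kernel \<phi>) (\<xi> + real_vec m))"
  by (simp add: w_fun_def fibre_norm_def)

lemma infsum_measurable [measurable (raw)]:
  fixes f :: "'a::countable \<Rightarrow> 'b \<Rightarrow> ennreal"
  assumes "\<And>m. f m \<in> borel_measurable M"
  shows "(\<lambda>x. \<Sum>\<^sub>\<infinity>m. f m x) \<in> borel_measurable M"
proof -
  interpret count: sigma_finite_measure "count_space (UNIV :: 'a set)"
    by (rule sigma_finite_measure_count_space)
  have "(\<lambda>(m, x). f m x) \<in> borel_measurable (count_space UNIV \<Otimes>\<^sub>M M)"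
    using assms by (intro measurable_pair_measure_countable1) auto
  then have "(\<lambda>(x, m). f m x) \<in> borel_measurable (M \<Otimes>\<^sub>M count_space UNIV)"
    by (subst measurable_pair_swap_iff) simp
  then show ?thesis
    unfolding infsum_ennreal_eq_nn_integral by (rule count.borel_measurable_nn_integral)
qed

lemma w_fun_measurable:
  fixes \<phi> :: "(real ^ 'n) \<times> (real ^ 'n) \<Rightarrow> complex"
  assumes [measurable]: "weyl_kernel \<phi> \<in> borel_measurable borel"
  shows "w_fun \<phi> \<in> borel_measurable borel"
  unfolding w_fun_eq[abs_def] by measurable

lemma nn_integral_torus_times_w_fun:
  fixes \<phi> :: "(real ^ 'n) \<times> (real ^ 'n) \<Rightarrow> complex"
  assumes K [measurable]: "weyl_kernel \<phi> \<in> borel_measurable borel"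
    and [measurable]: "g \<in> borel_measurable borel" and per: "\<And>\<xi> m. g (\<xi> + real_vec m) = g \<xi>"
  shows "(\<integral>\<^sup>+\<xi>. ennreal ((cmod (g \<xi>))\<^sup>2) * w_fun \<phi> \<xi> \<partial>torus)
    = sqnorm lborel (\<lambda>p. g (fst p) * weyl_kernel \<phi> p)"
proof -
  have "ennreal ((cmod (g \<xi>))\<^sup>2) * w_fun \<phi> \<xi>
      = (\<Sum>\<^sub>\<infinity>m. ennreal ((cmod (g (\<xi> + real_vec m)))\<^sup>2) * fibre_norm (weyl_kernel \<phi>) (\<xi> + real_vec m))" for \<xi>
    unfolding w_fun_eq per infsum_ennreal_eq_nn_integral by (rule nn_integral_cmult[symmetric]) simp
  then have "(\<integral>\<^sup>+\<xi>. ennreal ((cmod (g \<xi>))\<^sup>2) * w_fun \<phi> \<xi> \<partial>torus)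
      = (\<integral>\<^sup>+\<xi>. ennreal ((cmod (g \<xi>))\<^sup>2) * fibre_norm (weyl_kernel \<phi>) \<xi> \<partial>lborel)"
    using nn_integral_periodization[of "\<lambda>\<xi>. ennreal ((cmod (g \<xi>))\<^sup>2) * fibre_norm (weyl_kernel \<phi>) \<xi>"] by simp
  also have "\<dots> = (\<integral>\<^sup>+\<xi>. \<integral>\<^sup>+\<eta>. ennreal ((cmod (g \<xi> * weyl_kernel \<phi> (\<xi>, \<eta>)))\<^sup>2) \<partial>lborel \<partial>lborel)"
  proof (rule nn_integral_cong)
    fix \<xi>
    note [measurable] = borel_pair_measurable[OF K]
    show "ennreal ((cmod (g \<xi>))\<^sup>2) * fibre_norm (weyl_kernel \<phi>) \<xi>
        = (\<integral>\<^sup>+\<eta>. ennreal ((cmod (g \<xi> * weyl_kernel \<phi> (\<xi>, \<eta>)))\<^sup>2) \<partial>lborel)"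
      unfolding fibre_norm_def by (simp add: norm_mult power_mult_distrib ennreal_mult nn_integral_cmult)
  qed
  also have "\<dots> = sqnorm lborel (\<lambda>p. g (fst p) * weyl_kernel \<phi> p)"
  proof -
    have [measurable]: "(\<lambda>p. g (fst p)) \<in> borel_measurable (borel :: ((real ^ 'n) \<times> (real ^ 'n)) measure)"
      unfolding borel_prod[symmetric] by measurable
    show ?thesis unfolding sqnorm_def by (subst nn_integral_slices(2)) auto
  qed
  finally show ?thesis .
qed

text \<open>
  At each point the cutoff has no effect once its radius is large, and the translates themselves
  dominate.
\<close>

lemma sqnorm_translates_cutoff_tendsto:
  fixes f :: "(real ^ 'n) \<times> (real ^ 'n) \<Rightarrow> complex"
  assumes fm [measurable]: "f \<in> borel_measurable borel" and F: "finite F"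
    and L2: "\<And>k. k \<in> F \<Longrightarrow> twisted_translation k 0 f \<in> L2_space lborel"
  shows "(\<lambda>N. sqnorm lborel (\<lambda>p. \<Sum>k\<in>F. c k * twisted_translation k 0 (cutoff (real N) f) p))
     \<longlonglongrightarrow> sqnorm lborel (\<lambda>p. \<Sum>k\<in>F. c k * twisted_translation k 0 f p)"
  unfolding sqnorm_def
proof (rule nn_integral_dominated_convergence[where
      w = "\<lambda>p. ennreal (real (card F) * (\<Sum>k\<in>F. (cmod (c k * twisted_translation k 0 f p))\<^sup>2))"])
  have le: "cmod (twisted_translation k 0 (cutoff (real N) f) p) \<le> cmod (twisted_translation k 0 f p)" for k N p
    by (cases p) (simp add: twisted_translation_0 norm_mult cutoff_def)
  show "AE p in lborel. ennreal ((cmod (\<Sum>k\<in>F. c k * twisted_translation k 0 (cutoff (real N) f) p))\<^sup>2)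
      \<le> ennreal (real (card F) * (\<Sum>k\<in>F. (cmod (c k * twisted_translation k 0 f p))\<^sup>2))" for N
    by (intro AE_I2 ennreal_leI order_trans[OF cmod_sum_sq_le] mult_left_mono sum_mono power_mono)
       (auto simp: norm_mult intro!: mult_left_mono le)
  have "(\<integral>\<^sup>+p. ennreal (real (card F) * (\<Sum>k\<in>F. (cmod (c k * twisted_translation k 0 f p))\<^sup>2)) \<partial>lborel)
      = ennreal (real (card F)) * (\<Sum>k\<in>F. sqnorm lborel (\<lambda>p. c k * twisted_translation k 0 f p))"
  proof -
    have "ennreal (real (card F) * (\<Sum>k\<in>F. (cmod (c k * twisted_translation k 0 f p))\<^sup>2))
       = ennreal (real (card F)) * (\<Sum>k\<in>F. ennreal ((cmod (c k * twisted_translation k 0 f p))\<^sup>2))" for p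
      by (simp add: ennreal_mult sum_nonneg)
    then show ?thesis by (simp only:) (subst nn_integral_cmult, simp, subst nn_integral_sum, auto simp: sqnorm_def)
  qed
  also have "\<dots> < \<infinity>"
    using L2 F by (auto simp: sqnorm_cmult L2_space_iff ennreal_mult_less_top)
  finally show "(\<integral>\<^sup>+p. ennreal (real (card F) * (\<Sum>k\<in>F. (cmod (c k * twisted_translation k 0 f p))\<^sup>2)) \<partial>lborel) < \<infinity>" .
  show "AE p in lborel. (\<lambda>N. ennreal ((cmod (\<Sum>k\<in>F. c k * twisted_translation k 0 (cutoff (real N) f) p))\<^sup>2))
      \<longlonglongrightarrow> ennreal ((cmod (\<Sum>k\<in>F. c k * twisted_translation k 0 f p))\<^sup>2)"
  proof (intro AE_I2 tendsto_ennrealI tendsto_power tendsto_norm tendsto_sum tendsto_mult tendsto_const tendsto_eventually)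
    fix p :: "(real ^ 'n) \<times> (real ^ 'n)" and k :: "int ^ 'n"
    obtain x y where p: "p = (x, y)" by (cases p)
    obtain N0 :: nat where N0: "norm (x - real_vec k) < real N0" using reals_Archimedean2 by blast
    show "\<forall>\<^sub>F N in sequentially. twisted_translation k 0 (cutoff (real N) f) p = twisted_translation k 0 f p"
      using eventually_ge_at_top[of N0]
    proof eventually_elim
      case (elim N)
      then have "norm (x - real_vec k) < real N" using N0 by linarith
      then show ?case by (simp add: p twisted_translation_0 cutoff_def)
    qed
  qed
qed measurable

text \<open>The estimate for the truncated kernels passes to the limit on both sides.\<close>

lemma sqnorm_trig_weyl_kernel_le:
  fixes \<phi> :: "(real ^ 'n) \<times> (real ^ 'n) \<Rightarrow> complex"
  assumes \<phi>: "\<phi> \<in> L2_space lborel" and F: "finite F"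
    and L2: "\<And>k. k \<in> F \<Longrightarrow> twisted_translation k 0 \<phi> \<in> L2_space lborel"
  shows "sqnorm lborel (\<lambda>p. trig F c (fst p) * weyl_kernel \<phi> p)
    \<le> sqnorm lborel (\<lambda>p. \<Sum>k\<in>F. c k * twisted_translation k 0 \<phi> p)"
proof -
  have fm [measurable]: "\<phi> \<in> borel_measurable borel" using \<phi> by (simp add: L2_space_iff)
  have K: "weyl_kernel \<phi> \<in> L2_space lborel" "L2_tendsto lborel (\<lambda>N. truncated_weyl_kernel N \<phi>) (weyl_kernel \<phi>)"
    using is_weyl_kernel_weyl_kernel[OF \<phi>] by (auto simp: is_weyl_kernel_def)
  have [measurable]: "weyl_kernel \<phi> \<in> borel_measurable borel" using K(1) by (simp add: L2_space_iff)
  have [measurable]: "(\<lambda>p. trig F c (fst p)) \<in> borel_measurable (borel :: ((real ^ 'n) \<times> (real ^ 'n)) measure)"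
    unfolding borel_prod[symmetric] by measurable
  define C where "C = (\<Sum>k\<in>F. cmod (c k))"
  have lim: "L2_tendsto lborel (\<lambda>N p. trig F c (fst p) * truncated_weyl_kernel N \<phi> p) (\<lambda>p. trig F c (fst p) * weyl_kernel \<phi> p)"
    unfolding L2_tendsto_iff
  proof (rule tendsto_sandwich[OF _ _ tendsto_const])
    have "(\<lambda>N. ennreal (C\<^sup>2) * sqnorm lborel (\<lambda>p. truncated_weyl_kernel N \<phi> p - weyl_kernel \<phi> p)) \<longlonglongrightarrow> ennreal (C\<^sup>2) * 0"
      using K(2) unfolding L2_tendsto_iff by (intro ennreal_tendsto_cmult) auto
    then show "(\<lambda>N. ennreal (C\<^sup>2) * sqnorm lborel (\<lambda>p. truncated_weyl_kernel N \<phi> p - weyl_kernel \<phi> p)) \<longlonglongrightarrow> 0" by simp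
    have "sqnorm lborel (\<lambda>p. trig F c (fst p) * truncated_weyl_kernel N \<phi> p - trig F c (fst p) * weyl_kernel \<phi> p)
      \<le> sqnorm lborel (\<lambda>p. of_real C * (truncated_weyl_kernel N \<phi> p - weyl_kernel \<phi> p))" for N
    proof (rule sqnorm_mono)
      fix p :: "(real ^ 'n) \<times> (real ^ 'n)"
      have "cmod (trig F c (fst p)) \<le> C" "0 \<le> C"
        using norm_trig_le[of F c "fst p"] by (simp_all add: C_def sum_nonneg)
      then show "cmod (trig F c (fst p) * truncated_weyl_kernel N \<phi> p - trig F c (fst p) * weyl_kernel \<phi> p)
        \<le> cmod (of_real C * (truncated_weyl_kernel N \<phi> p - weyl_kernel \<phi> p))"
        by (simp add: norm_mult mult_right_mono flip: right_diff_distrib)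
    qed
    then show "\<forall>\<^sub>F N in sequentially. sqnorm lborel (\<lambda>p. trig F c (fst p) * truncated_weyl_kernel N \<phi> p - trig F c (fst p) * weyl_kernel \<phi> p)
      \<le> ennreal (C\<^sup>2) * sqnorm lborel (\<lambda>p. truncated_weyl_kernel N \<phi> p - weyl_kernel \<phi> p)"
      by (simp add: sqnorm_cmult)
  qed auto
  show ?thesis
    by (rule sqnorm_limit_le[OF _ _ lim sqnorm_trig_truncated_weyl_kernel_le[OF \<phi> F]
          sqnorm_translates_cutoff_tendsto[OF fm F L2]]) measurable
qed

theorem theorem5p1:
  fixes \<phi> :: "(real ^ 'n) \<times> (real ^ 'n) \<Rightarrow> complex"
  assumes "\<phi> \<in> L2_space lborel"
    and "condition_C \<phi>"
    and "(\<integral>\<^sup>+\<xi>. 1 / w_fun \<phi> \<xi> \<partial>torus) < \<infinity>"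
    and "hilbertian_L2 lborel
           (\<lambda>j :: int ^ ('n + 'n). twisted_translation (\<chi> i. j $ Inl i) (\<chi> i. j $ Inr i) \<phi>)"
  shows "esssup torus (w_fun \<phi>) < \<infinity>"
proof -
  define T where "T j = twisted_translation (\<chi> i. j $ Inl i) (\<chi> i. j $ Inr i) \<phi>" for j :: "int ^ ('n + 'n)"
  \<comment> \<open>The coefficients are supported on the indices \<open>(k, 0)\<close>.\<close>
  define emb :: "int ^ 'n \<Rightarrow> int ^ ('n + 'n)" where "emb k = (\<chi> s. case s of Inl i \<Rightarrow> k $ i | Inr i \<Rightarrow> 0)" for k
  have emb: "(\<chi> i. emb k $ Inl i) = k" "(\<chi> i. emb k $ Inr i) = 0" for k
    by (simp_all add: emb_def vec_eq_iff)
  have inj: "inj_on emb F" for F by (rule inj_on_inverseI[where g = "\<lambda>j. \<chi> i. j $ Inl i"]) (rule emb)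
  have H: "hilbertian_L2 lborel T" using assms(4) by (simp add: T_def[abs_def])
  have T_emb: "T (emb k) = twisted_translation k 0 \<phi>" for k by (simp add: T_def emb)
  have L2: "twisted_translation k 0 \<phi> \<in> L2_space lborel" for k
    using H unfolding hilbertian_L2_def T_emb[symmetric] by blast
  obtain B where B: "B \<ge> 0" "\<And>F c. finite F \<Longrightarrow> sqnorm lborel (\<lambda>p. \<Sum>j\<in>F. c j * T j p) \<le> ennreal (B * (\<Sum>j\<in>F. (cmod (c j))\<^sup>2))"
    using hilbertian_bound[OF H] by blast
  \<comment> \<open>A positive constant is wanted below, hence \<open>B + 1\<close>.\<close>
  have translates: "sqnorm lborel (\<lambda>p. \<Sum>k\<in>F. c k * twisted_translation k 0 \<phi> p) \<le> ennreal ((B + 1) * (\<Sum>k\<in>F. (cmod (c k))\<^sup>2))"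
    if F: "finite F" for F and c :: "int ^ 'n \<Rightarrow> complex"
  proof -
    have "sqnorm lborel (\<lambda>p. \<Sum>k\<in>F. c k * twisted_translation k 0 \<phi> p) \<le> ennreal (B * (\<Sum>k\<in>F. (cmod (c k))\<^sup>2))"
      using B(2)[of "emb ` F" "\<lambda>j. c (\<chi> i. j $ Inl i)"] F
      by (simp add: sum.reindex[OF inj] emb T_emb)
    also have "\<dots> \<le> ennreal ((B + 1) * (\<Sum>k\<in>F. (cmod (c k))\<^sup>2))"
      by (intro ennreal_leI mult_right_mono sum_nonneg) auto
    finally show ?thesis .
  qed
  have Km: "weyl_kernel \<phi> \<in> borel_measurable borel" and K_fin: "sqnorm lborel (weyl_kernel \<phi>) < \<infinity>"
    using is_weyl_kernel_weyl_kernel[OF assms(1)] by (auto simp: is_weyl_kernel_def L2_space_iff)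
  note wm = w_fun_measurable[OF Km]
  have "AE \<xi> in torus. w_fun \<phi> \<xi> \<le> ennreal (B + 1)"
  proof (rule AE_le_of_trig_bound[OF wm])
    show "(\<integral>\<^sup>+\<xi>. w_fun \<phi> \<xi> \<partial>torus) < \<infinity>"
      using nn_integral_torus_times_w_fun[OF Km, of "\<lambda>_. 1"] K_fin by simp
    show "B + 1 > 0" using B(1) by simp
    fix F :: "(int ^ 'n) set" and c assume F: "finite F"
    have "(\<integral>\<^sup>+\<xi>. ennreal ((cmod (trig F c \<xi>))\<^sup>2) * w_fun \<phi> \<xi> \<partial>torus)
        = sqnorm lborel (\<lambda>p. trig F c (fst p) * weyl_kernel \<phi> p)"
      by (rule nn_integral_torus_times_w_fun[OF Km]) (auto simp: trig_def character_periodic)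
    also have "\<dots> \<le> sqnorm lborel (\<lambda>p. \<Sum>k\<in>F. c k * twisted_translation k 0 \<phi> p)"
      by (rule sqnorm_trig_weyl_kernel_le[OF assms(1) F L2])
    also have "\<dots> \<le> ennreal ((B + 1) * (\<Sum>k\<in>F. (cmod (c k))\<^sup>2))" by (rule translates[OF F])
    also have "\<dots> = ennreal (B + 1) * sqnorm torus (trig F c)"
      using B(1) by (simp add: sqnorm_torus_trig[OF F] ennreal_mult sum_nonneg)
    finally show "(\<integral>\<^sup>+\<xi>. ennreal ((cmod (trig F c \<xi>))\<^sup>2) * w_fun \<phi> \<xi> \<partial>torus) \<le> ennreal (B + 1) * sqnorm torus (trig F c)" .
  qed
  then have "esssup torus (w_fun \<phi>) \<le> ennreal (B + 1)"
    using wm by (intro esssup_I) auto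
  then show ?thesis by (rule le_less_trans) simp
qed

end
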